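(* Let $\alpha\in\mathbb{C}\setminus\{0,-1\}$. On the superspace with even coordinates $x,y$ and odd coordinates $\eta,\theta$, consider the differential operators $$\mathbb{E}=x\partial_x+y\partial_y+\eta\partial_\eta+\theta\partial_\theta,\qquad\Delta=\partial_x\partial_y+\partial_\eta\partial_\theta,$$ $$\mathbb{E}_\alpha=\alpha x\partial_x+y\partial_y+\alpha\eta\partial_\eta+\theta\partial_\theta,\qquad\Delta_\alpha=\partial_x\partial_y+\alpha\partial_\eta\partial_\theta .$$ A realisation of the Lie superalgebra $D(2,1;\alpha)$ is given by the operators $$x,\quad y,\quad\theta,\quad\eta,$$ $$\theta\partial_\theta-\eta\partial_\eta,\quad x\partial_x-y\partial_y,\quad\mathbb{E},\quad\theta\partial_\eta,\quad\eta\partial_\theta,\quad\eta\partial_y+\alpha x\partial_\theta,\quad\theta\partial_x-y\partial_\eta,\quad\theta\partial_y-\alpha x\partial_\eta,\quad\eta\partial_x+y\partial_\theta,$$ and $$\mathbb{E}\partial_x-y\Delta,\quad\mathbb{E}\partial_y-x\Delta_\alpha,\quad\mathbb{E}_\alpha\partial_\theta+\eta\Delta,\quad\mathbb{E}_\alpha\partial_\eta-\theta\Delta_\alpha ;$$ that is, these 17 operators form a basis of a Lie sub-superalgebra (under the supercommutator) of the Weyl superalgebra $\mathscr{A}(\mathbb{C}^{2|2})$ which is isomorphic to $D(2,1;\alpha)$.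
   Context: The ground field is $\mathbb{C}$. $\mathscr{A}(\mathbb{C}^{2|2})$ is the algebra of polynomial differential operators on $\mathbb{C}[x,y]\otimes\Lambda(\theta,\eta)$, generated by multiplication by $x,y$ (even), $\theta,\eta$ (odd) and the super derivations $\partial_x,\partial_y$ (even), $\partial_\theta,\partial_\eta$ (odd). A realisation of a Lie superalgebra is an injective Lie superalgebra morphism into such a Weyl superalgebra with supercommutator bracket. $D(2,1;\alpha)$ (for $\alpha\ne0,-1$) is the simple Lie superalgebra of dimension $9|8$ with Cartan matrix $\begin{pmatrix}2&-1&0\\-1&0&-\alpha\\0&-1&2\end{pmatrix}$ (entries $a_{ij}=\alpha_j(h_i)$), the middle simple root being odd and the other two even. Its even and odd roots are $\{\pm2\delta_1,\pm2\delta_2,\pm2\delta_3\}$ and $\{\pm\delta_1\pm\delta_2\pm\delta_3\}$, with simple roots $2\delta_2,\ \delta_1-\delta_2-\delta_3,\ 2\delta_3$. *)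

theory Defs
  imports
    "HOL-Analysis.Analysis"
    "HOL-Library.Function_Algebras"
    "HOL-Library.Z2"
    "HOL-Computational_Algebra.Polynomial"
begin

section \<open>Lie superalgebras over the complex numbers\<close>

text \<open>
  The two homogeneous parts are subspaces of an ambient complex vector space; the Lie superalgebra
  is their direct sum inside that space, and the bracket is only constrained there. The type
  \<^typ>\<open>bit\<close> is \<open>\<int>/2\<close>, so parities are added modulo 2.
\<close>

record 'a lsa =
  scl :: "complex \<Rightarrow> 'a \<Rightarrow> 'a"
  part :: "bit \<Rightarrow> 'a set"
  brk :: "'a \<Rightarrow> 'a \<Rightarrow> 'a"

definition lcarrier :: "'a::ab_group_add lsa \<Rightarrow> 'a set" where
  "lcarrier G = {a + b |a b. a \<in> part G 0 \<and> b \<in> part G 1}"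

definition super_sign :: "bit \<Rightarrow> bit \<Rightarrow> complex" where
  "super_sign i j = (if i = 1 \<and> j = 1 then - 1 else 1)"

locale lie_superalgebra = vector_space "scl G" for G :: "'a::ab_group_add lsa" +
  assumes part_subspace: "subspace (part G i)"
    and part_disjoint: "part G 0 \<inter> part G 1 = {0}"
    and brk_part: "\<lbrakk>a \<in> part G i; b \<in> part G j\<rbrakk> \<Longrightarrow> brk G a b \<in> part G (i + j)"
    and brk_add_left: "\<lbrakk>a \<in> lcarrier G; b \<in> lcarrier G; c \<in> lcarrier G\<rbrakk>
      \<Longrightarrow> brk G (a + b) c = brk G a c + brk G b c"
    and brk_add_right: "\<lbrakk>a \<in> lcarrier G; b \<in> lcarrier G; c \<in> lcarrier G\<rbrakk>
      \<Longrightarrow> brk G a (b + c) = brk G a b + brk G a c"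
    and brk_scale_left: "\<lbrakk>a \<in> lcarrier G; b \<in> lcarrier G\<rbrakk>
      \<Longrightarrow> brk G (scl G r a) b = scl G r (brk G a b)"
    and brk_scale_right: "\<lbrakk>a \<in> lcarrier G; b \<in> lcarrier G\<rbrakk>
      \<Longrightarrow> brk G a (scl G r b) = scl G r (brk G a b)"
    and super_skew: "\<lbrakk>a \<in> part G i; b \<in> part G j\<rbrakk>
      \<Longrightarrow> brk G a b = - scl G (super_sign i j) (brk G b a)"
    and super_jacobi: "\<lbrakk>a \<in> part G i; b \<in> part G j; c \<in> part G k\<rbrakk>
      \<Longrightarrow> brk G a (brk G b c) =
          brk G (brk G a b) c + scl G (super_sign i j) (brk G b (brk G a c))"

text \<open>Subalgebras and ideals are \<open>\<int>/2\<close>-graded, as usual for superalgebras.\<close>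

definition graded_subspace :: "'a::ab_group_add lsa \<Rightarrow> 'a set \<Rightarrow> bool" where
  "graded_subspace G S \<longleftrightarrow> module.subspace (scl G) S \<and>
     S = {a + b |a b. a \<in> part G 0 \<inter> S \<and> b \<in> part G 1 \<inter> S}"

definition lsa_subalgebra :: "'a::ab_group_add lsa \<Rightarrow> 'a set \<Rightarrow> bool" where
  "lsa_subalgebra G S \<longleftrightarrow> graded_subspace G S \<and> (\<forall>a\<in>S. \<forall>b\<in>S. brk G a b \<in> S)"

definition lsa_ideal :: "'a::ab_group_add lsa \<Rightarrow> 'a set \<Rightarrow> bool" where
  "lsa_ideal G S \<longleftrightarrow> graded_subspace G S \<and> (\<forall>a\<in>lcarrier G. \<forall>b\<in>S. brk G a b \<in> S)"

definition sub_lsa :: "'a lsa \<Rightarrow> 'a set \<Rightarrow> 'a lsa" where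
  "sub_lsa G S = G\<lparr>part := \<lambda>i. part G i \<inter> S\<rparr>"

definition lsa_simple :: "'a::ab_group_add lsa \<Rightarrow> bool" where
  "lsa_simple G \<longleftrightarrow> lie_superalgebra G \<and>
     (\<exists>a\<in>lcarrier G. \<exists>b\<in>lcarrier G. brk G a b \<noteq> 0) \<and>
     (\<forall>I. lsa_ideal G I \<longrightarrow> I = {0} \<or> I = lcarrier G)"

definition lsa_hom :: "'a::ab_group_add lsa \<Rightarrow> 'b::ab_group_add lsa \<Rightarrow> ('a \<Rightarrow> 'b) \<Rightarrow> bool" where
  "lsa_hom G H \<phi> \<longleftrightarrow>
     (\<forall>i. \<forall>a\<in>part G i. \<phi> a \<in> part H i) \<and>
     (\<forall>a\<in>lcarrier G. \<forall>b\<in>lcarrier G. \<phi> (a + b) = \<phi> a + \<phi> b) \<and>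
     (\<forall>k. \<forall>a\<in>lcarrier G. \<phi> (scl G k a) = scl H k (\<phi> a)) \<and>
     (\<forall>a\<in>lcarrier G. \<forall>b\<in>lcarrier G. \<phi> (brk G a b) = brk H (\<phi> a) (\<phi> b))"


section \<open>The Lie superalgebra \<open>D(2,1;\<alpha>)\<close>\<close>

text \<open>
  Chevalley generators of \<open>G\<close> for a Cartan matrix \<open>A\<close>, where \<open>A $ i $ j = \<alpha>\<^sub>j(h\<^sub>i)\<close>,
  and \<open>\<tau> j\<close> is the parity of the simple root \<open>\<alpha>\<^sub>j\<close>. The last clause says that they generate
  \<open>G\<close>.
\<close>

definition chevalley_generators ::
  "'a::ab_group_add lsa \<Rightarrow> complex^'n^'n \<Rightarrow> ('n \<Rightarrow> bit) \<Rightarrow>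
   ('n \<Rightarrow> 'a) \<Rightarrow> ('n \<Rightarrow> 'a) \<Rightarrow> ('n \<Rightarrow> 'a) \<Rightarrow> bool" where
  "chevalley_generators G A \<tau> h e f \<longleftrightarrow>
     (\<forall>i. h i \<in> part G 0 \<and> e i \<in> part G (\<tau> i) \<and> f i \<in> part G (\<tau> i)) \<and>
     inj h \<and> \<not> module.dependent (scl G) (range h) \<and>
     (\<forall>i j. brk G (h i) (h j) = 0 \<and>
            brk G (e i) (f j) = (if i = j then h i else 0) \<and>
            brk G (h i) (e j) = scl G (A $ i $ j) (e j) \<and>
            brk G (h i) (f j) = scl G (- (A $ i $ j)) (f j)) \<and>
     (\<forall>S. lsa_subalgebra G S \<and> range h \<union> range e \<union> range f \<subseteq> S \<longrightarrow> S = lcarrier G)"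

definition D21_cartan :: "complex \<Rightarrow> complex^3^3" where
  "D21_cartan \<alpha> = vector
     [vector [ 2, -1,   0],
      vector [-1,  0, - \<alpha>],
      vector [ 0, -1,   2]]"

definition D21_parity :: "3 \<Rightarrow> bit" where
  "D21_parity i = (if i = 2 then 1 else 0)"

text \<open>
  \<open>D(2,1;\<alpha>)\<close> is described by its defining properties, which determine it up to isomorphism
  for \<open>\<alpha> \<noteq> 0, -1\<close>: \<open>is_D21 \<alpha> G\<close> says that \<open>G\<close> is a copy of \<open>D(2,1;\<alpha>)\<close>.
\<close>

definition is_D21 :: "complex \<Rightarrow> 'a::ab_group_add lsa \<Rightarrow> bool" where
  "is_D21 \<alpha> G \<longleftrightarrow> lsa_simple G \<and>
     vector_space.dim (scl G) (part G 0) = 9 \<and> vector_space.dim (scl G) (part G 1) = 8 \<and>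
     (\<exists>h e f. chevalley_generators G (D21_cartan \<alpha>) D21_parity h e f)"


section \<open>The Weyl superalgebra of \<open>\<complex>\<^bsup>2|2\<^esup>\<close>\<close>

text \<open>
  \<open>\<complex>[x,y]\<close> is \<^typ>\<open>complex poly poly\<close>: the outer variable is \<open>y\<close>, the coefficients are
  polynomials in \<open>x\<close>. The quadruple \<open>(a, b, c, d)\<close> stands for the element
  \<open>a + b\<theta> + c\<eta> + d\<theta>\<eta>\<close> of \<open>\<complex>[x,y] \<otimes> \<Lambda>(\<theta>,\<eta>)\<close>.
\<close>

type_synonym cpoly2 = "complex poly poly"
type_synonym superpoly = "cpoly2 \<times> cpoly2 \<times> cpoly2 \<times> cpoly2"
type_synonym superop = "superpoly \<Rightarrow> superpoly"

fun coeffwise :: "(cpoly2 \<Rightarrow> cpoly2) \<Rightarrow> superop" where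
  "coeffwise F (a, b, c, d) = (F a, F b, F c, F d)"

fun superpoly_proj :: "bit \<Rightarrow> superop" where
  "superpoly_proj i (a, b, c, d) = (if i = 0 then (a, 0, 0, d) else (0, b, c, 0))"

definition superpoly_part :: "bit \<Rightarrow> superpoly set" where
  "superpoly_part i = range (superpoly_proj i)"

definition op_scale :: "complex \<Rightarrow> superop \<Rightarrow> superop" (infixr "\<star>" 75) where
  "k \<star> D = (\<lambda>p. coeffwise (smult [:k:]) (D p))"

text \<open>The product of operators is composition; \<open>*\<close> on functions is the pointwise product.\<close>

abbreviation op_mult :: "superop \<Rightarrow> superop \<Rightarrow> superop" (infixl "\<odot>" 70) where
  "A \<odot> B \<equiv> A \<circ> B"

definition op_x :: superop where "op_x = coeffwise (\<lambda>p. [:[:0, 1:]:] * p)"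
definition op_y :: superop where "op_y = coeffwise (\<lambda>p. [:0, 1:] * p)"
definition d_x :: superop where "d_x = coeffwise (map_poly pderiv)"
definition d_y :: superop where "d_y = coeffwise pderiv"

text \<open>Left multiplication by the odd coordinates, and the odd left superderivations.\<close>

fun op_theta :: superop where "op_theta (a, b, c, d) = (0, a, 0, c)"
fun op_eta :: superop where "op_eta (a, b, c, d) = (0, 0, a, - b)"
fun d_theta :: superop where "d_theta (a, b, c, d) = (b, 0, d, 0)"
fun d_eta :: superop where "d_eta (a, b, c, d) = (c, - d, 0, 0)"

inductive_set weyl :: "superop set" where
  weyl_gen: "D \<in> {op_x, op_y, op_theta, op_eta, d_x, d_y, d_theta, d_eta} \<Longrightarrow> D \<in> weyl"
| weyl_one: "id \<in> weyl"
| weyl_add: "\<lbrakk>A \<in> weyl; B \<in> weyl\<rbrakk> \<Longrightarrow> A + B \<in> weyl"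
| weyl_scale: "A \<in> weyl \<Longrightarrow> k \<star> A \<in> weyl"
| weyl_mult: "\<lbrakk>A \<in> weyl; B \<in> weyl\<rbrakk> \<Longrightarrow> A \<odot> B \<in> weyl"

definition weyl_part :: "bit \<Rightarrow> superop set" where
  "weyl_part i = {D \<in> weyl. \<forall>j. \<forall>p\<in>superpoly_part j. D p \<in> superpoly_part (i + j)}"

text \<open>
  \<open>op_homog i D\<close> is the component of \<open>D\<close> of parity \<open>i\<close>; the supercommutator is the bilinear
  extension of \<open>[A,B] = AB - (-1)\<^bsup>|A||B|\<^esup>BA\<close> from homogeneous operators.
\<close>

definition op_homog :: "bit \<Rightarrow> superop \<Rightarrow> superop" where
  "op_homog i D = superpoly_proj i \<odot> D \<odot> superpoly_proj 0
     + superpoly_proj (i + 1) \<odot> D \<odot> superpoly_proj 1"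

definition supercommutator :: "superop \<Rightarrow> superop \<Rightarrow> superop" where
  "supercommutator A B = (\<Sum>i\<in>{0, 1}. \<Sum>j\<in>{0, 1}.
     op_homog i A \<odot> op_homog j B - super_sign i j \<star> (op_homog j B \<odot> op_homog i A))"

definition weyl_lsa :: "superop lsa" where
  "weyl_lsa = \<lparr>scl = op_scale, part = weyl_part, brk = supercommutator\<rparr>"

definition realisation :: "'a::ab_group_add lsa \<Rightarrow> ('a \<Rightarrow> superop) \<Rightarrow> bool" where
  "realisation G \<rho> \<longleftrightarrow> lsa_hom G weyl_lsa \<rho> \<and> inj_on \<rho> (lcarrier G)"


section \<open>The seventeen operators\<close>

definition op_E :: superop where
  "op_E = op_x \<odot> d_x + op_y \<odot> d_y + op_eta \<odot> d_eta + op_theta \<odot> d_theta"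

definition op_Delta :: superop where
  "op_Delta = d_x \<odot> d_y + d_eta \<odot> d_theta"

definition op_E_alpha :: "complex \<Rightarrow> superop" where
  "op_E_alpha \<alpha> = \<alpha> \<star> (op_x \<odot> d_x) + op_y \<odot> d_y
     + \<alpha> \<star> (op_eta \<odot> d_eta) + op_theta \<odot> d_theta"

definition op_Delta_alpha :: "complex \<Rightarrow> superop" where
  "op_Delta_alpha \<alpha> = d_x \<odot> d_y + \<alpha> \<star> (d_eta \<odot> d_theta)"

definition D21_ops :: "complex \<Rightarrow> superop list" where
  "D21_ops \<alpha> =
    [op_x, op_y, op_theta, op_eta,
     op_theta \<odot> d_theta - op_eta \<odot> d_eta,
     op_x \<odot> d_x - op_y \<odot> d_y,
     op_E,
     op_theta \<odot> d_eta,
     op_eta \<odot> d_theta,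
     op_eta \<odot> d_y + \<alpha> \<star> (op_x \<odot> d_theta),
     op_theta \<odot> d_x - op_y \<odot> d_eta,
     op_theta \<odot> d_y - \<alpha> \<star> (op_x \<odot> d_eta),
     op_eta \<odot> d_x + op_y \<odot> d_theta,
     op_E \<odot> d_x - op_y \<odot> op_Delta,
     op_E \<odot> d_y - op_x \<odot> op_Delta_alpha \<alpha>,
     op_E_alpha \<alpha> \<odot> d_theta + op_eta \<odot> op_Delta,
     op_E_alpha \<alpha> \<odot> d_eta - op_theta \<odot> op_Delta_alpha \<alpha>]"

definition D21_span :: "complex \<Rightarrow> superop set" where
  "D21_span \<alpha> = module.span op_scale (set (D21_ops \<alpha>))"

end

theory Submission
  imports Defs
begin

text \<open>
  The supercommutators of the seventeen operators are linear combinations of these operators, with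
  coefficients linear in \<open>\<alpha>\<close>, so the operators span a Lie superalgebra of dimension \<open>9|8\<close>.
  It is simple: an ideal is stable under a Cartan element that separates the fourteen roots, hence
  contains a root vector, and from any root vector brackets lead to all others.

  A copy of \<open>D(2,1;\<alpha>)\<close> is only given by simplicity and Chevalley generators, so one has to see that
  these determine it. Let \<open>G\<close> and \<open>H\<close> be two such Lie superalgebras, and let \<open>D\<close> be the subalgebra
  of \<open>G \<times> H\<close> generated by the pairs of corresponding generators. It has a triangular decomposition,
  and since \<open>det A = - 2(1 + \<alpha>) \<noteq> 0\<close> some Cartan element \<open>\<rho>\<close> has value 1 on all simple roots; hence
  the centraliser of \<open>\<rho>\<close> in \<open>D\<close> is the span of the pairs \<open>(h\<^sub>i, h'\<^sub>i)\<close> and contains neither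
  \<open>(h\<^sub>i, 0)\<close> nor \<open>(0, h'\<^sub>i)\<close>. So the ideals \<open>{a. (a, 0) \<in> D}\<close> and \<open>{b. (0, b) \<in> D}\<close> are proper, and
  by simplicity \<open>D\<close> is the graph of an isomorphism.
\<close>

section \<open>Lie superalgebras\<close>

text \<open>The uniqueness argument stands in for a presentation. No Serre relations are used, so
  words in the \<open>e i\<close> may be nonzero at arbitrary length. Only the component of height 0
  of the diagonal subalgebra has to be computed; simplicity does the rest.

  In the model, \<open>op_E\<close> grades the operators: x, y, theta, eta have degree 1, the nine
  first-order operators degree 0, the last four degree -1. A Cartan subalgebra is spanned by theta
  d_theta - eta d_eta, x d_x - y d_y and E; the other fourteen operators are root vectors. Those of
  the simple roots 2 delta_2, delta_1 - delta_2 - delta_3, 2 delta_3 are y, E_alpha d_theta + eta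
  Delta, x; those of the opposite roots are, up to scalars, E d_y - x Delta_alpha, theta, E d_x - y
  Delta.

  The excluded values of \<alpha> appear as structure constants: some brackets of root vectors are
  \<alpha> or 1 + \<alpha> times a root vector, up to sign, and these brackets tie the root spaces
  together.\<close>

lemma bit_UNIV_cases: "(i::bit) = 0 \<or> i = 1"
  by (cases i) auto

lemma sub_lsa_simps [simp]:
  "scl (sub_lsa G S) = scl G" "brk (sub_lsa G S) = brk G" "part (sub_lsa G S) i = part G i \<inter> S"
  by (simp_all add: sub_lsa_def)

context lie_superalgebra
begin

lemma part_lcarrier: "a \<in> part G i \<Longrightarrow> a \<in> lcarrier G"
  using bit_UNIV_cases[of i] subspace_0[OF part_subspace]
  by (force simp: lcarrier_def)

lemma subspace_lcarrier: "subspace (lcarrier G)"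
  unfolding lcarrier_def by (rule subspace_sums[OF part_subspace part_subspace])

lemma lcarrier_cases:
  assumes "a \<in> lcarrier G"
  obtains b c where "b \<in> part G 0" "c \<in> part G 1" "a = b + c"
  using assms by (auto simp: lcarrier_def)

lemma brk_lcarrier:
  assumes "a \<in> lcarrier G" "b \<in> lcarrier G"
  shows "brk G a b \<in> lcarrier G"
proof -
  obtain a0 a1 b0 b1 where a: "a0 \<in> part G 0" "a1 \<in> part G 1" "a = a0 + a1"
    and b: "b0 \<in> part G 0" "b1 \<in> part G 1" "b = b0 + b1"
    using assms by (auto elim!: lcarrier_cases)
  have "brk G a b = brk G a0 b0 + brk G a0 b1 + (brk G a1 b0 + brk G a1 b1)"
    using a b by (simp add: brk_add_left brk_add_right part_lcarrier subspace_add[OF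
      subspace_lcarrier])
  with a b show ?thesis
    by (auto intro!: subspace_add[OF subspace_lcarrier] intro: part_lcarrier[OF brk_part])
qed

section \<open>Sums, spans and graded subalgebras\<close>

lemma brk_zero_left [simp]: "a \<in> lcarrier G \<Longrightarrow> brk G 0 a = 0"
  using brk_scale_left[of 0 a 0] subspace_0[OF subspace_lcarrier] by simp

lemma brk_zero_right [simp]: "a \<in> lcarrier G \<Longrightarrow> brk G a 0 = 0"
  using brk_scale_right[of a 0 0] subspace_0[OF subspace_lcarrier] by simp

lemma brk_sum_right:
  assumes "a \<in> lcarrier G" "\<And>i. i \<in> I \<Longrightarrow> v i \<in> lcarrier G"
  shows "brk G a (\<Sum>i\<in>I. v i) = (\<Sum>i\<in>I. brk G a (v i))"
  using assms(2)
  by (induction I rule: infinite_finite_induct)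
    (auto simp: assms(1) brk_add_right subspace_sum[OF subspace_lcarrier])

lemma brk_sum_left:
  assumes "a \<in> lcarrier G" "\<And>i. i \<in> I \<Longrightarrow> v i \<in> lcarrier G"
  shows "brk G (\<Sum>i\<in>I. v i) a = (\<Sum>i\<in>I. brk G (v i) a)"
  using assms(2)
  by (induction I rule: infinite_finite_induct)
    (auto simp: assms(1) brk_add_left subspace_sum[OF subspace_lcarrier])

lemma span_lcarrier: "X \<subseteq> lcarrier G \<Longrightarrow> span X \<subseteq> lcarrier G"
  by (rule span_minimal[OF _ subspace_lcarrier])

lemma brk_span_right:
  assumes "a \<in> lcarrier G" "X \<subseteq> lcarrier G" "subspace S" "\<And>x. x \<in> X \<Longrightarrow> brk G a x \<in> S" "u \<in> span X"
  shows "brk G a u \<in> S"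
proof -
  have "u \<in> lcarrier G \<and> brk G a u \<in> S"
    using assms(5)
  proof (induction rule: span_induct_alt)
    case base
    then show ?case using assms subspace_0[OF subspace_lcarrier] subspace_0 by simp
  next
    case (step c x y)
    then have "x \<in> lcarrier G" "scl G c x \<in> lcarrier G"
      using assms subspace_scale[OF subspace_lcarrier] by auto
    with step assms show ?case
      by (simp add: brk_add_right brk_scale_right subspace_add[OF subspace_lcarrier]
          subspace_add[OF assms(3)] subspace_scale[OF assms(3)])
  qed
  then show ?thesis ..
qed

lemma brk_span_left:
  assumes "a \<in> lcarrier G" "X \<subseteq> lcarrier G" "subspace S" "\<And>x. x \<in> X \<Longrightarrow> brk G x a \<in> S" "u \<in> span X"
  shows "brk G u a \<in> S"
proof -
  have "u \<in> lcarrier G \<and> brk G u a \<in> S"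
    using assms(5)
  proof (induction rule: span_induct_alt)
    case base
    then show ?case using assms subspace_0[OF subspace_lcarrier] subspace_0 by simp
  next
    case (step c x y)
    then have "x \<in> lcarrier G" "scl G c x \<in> lcarrier G"
      using assms subspace_scale[OF subspace_lcarrier] by auto
    with step assms show ?case
      by (simp add: brk_add_left brk_scale_left subspace_add[OF subspace_lcarrier]
          subspace_add[OF assms(3)] subspace_scale[OF assms(3)])
  qed
  then show ?thesis ..
qed

lemma brk_span_closed:
  assumes "X \<subseteq> lcarrier G" "\<And>x y. x \<in> X \<Longrightarrow> y \<in> X \<Longrightarrow> brk G x y \<in> span X" "u \<in> span X" "v \<in> span X"
  shows "brk G u v \<in> span X"
proof (rule brk_span_left[OF _ assms(1) subspace_span _ assms(3)])
  show "v \<in> lcarrier G" using assms span_lcarrier[OF assms(1)] by auto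
  show "brk G x v \<in> span X" if "x \<in> X" for x
    using brk_span_right[OF _ assms(1) subspace_span _ assms(4)] assms(1,2) that by auto
qed

lemma graded_span:
  assumes "X \<subseteq> part G 0 \<union> part G 1"
  shows "graded_subspace G (span X)"
proof -
  let ?S = "{a + b |a b. a \<in> part G 0 \<inter> span X \<and> b \<in> part G 1 \<inter> span X}"
  have sub: "subspace ?S"
    by (intro subspace_sums subspace_inter part_subspace subspace_span)
  have "x \<in> ?S" if "x \<in> X" for x
    using assms that span_base[OF that] subspace_0[OF part_subspace] span_zero[of X] 
    by (cases "x \<in> part G 0") force+
  then have "span X \<subseteq> ?S"
    by (intro span_minimal[OF _ sub]) auto
  moreover have "?S \<subseteq> span X"
    by (auto intro: span_add)
  ultimately show ?thesis
    unfolding graded_subspace_def using subspace_span by blast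
qed

lemma span_subalgebra:
  assumes "X \<subseteq> part G 0 \<union> part G 1" "\<And>x y. x \<in> X \<Longrightarrow> y \<in> X \<Longrightarrow> brk G x y \<in> span X"
  shows "lsa_subalgebra G (span X)"
  unfolding lsa_subalgebra_def
proof (intro conjI ballI graded_span assms(1))
  show "brk G u v \<in> span X" if "u \<in> span X" "v \<in> span X" for u v
    using brk_span_closed[OF _ assms(2) that] assms(1) part_lcarrier by blast
qed

lemma lcarrier_sub_lsa:
  assumes "lsa_subalgebra G S"
  shows "lcarrier (sub_lsa G S) = S"
  using assms by (simp add: lsa_subalgebra_def graded_subspace_def lcarrier_def)

lemma graded_subspace_lcarrier: "graded_subspace G S \<Longrightarrow> S \<subseteq> lcarrier G"
  unfolding graded_subspace_def lcarrier_def by blast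

lemma lie_superalgebra_sub_lsa:
  assumes "lsa_subalgebra G S"
  shows "lie_superalgebra (sub_lsa G S)"
proof -
  have sub: "subspace S" and car: "S \<subseteq> lcarrier G" and cl: "\<And>a b. a \<in> S \<Longrightarrow> b \<in> S \<Longrightarrow> brk G a b \<in> S"
    using assms graded_subspace_lcarrier by (auto simp: lsa_subalgebra_def graded_subspace_def)
  interpret S: vector_space "scl (sub_lsa G S)"
    by (simp add: vector_space_axioms)
  show ?thesis
  proof
    show "S.subspace (part (sub_lsa G S) i)" for i
      using subspace_inter[OF part_subspace sub] by simp
    show "part (sub_lsa G S) 0 \<inter> part (sub_lsa G S) 1 = {0}"
      using part_disjoint subspace_0[OF sub] by auto
    show "brk (sub_lsa G S) a b \<in> part (sub_lsa G S) (i + j)"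
      if "a \<in> part (sub_lsa G S) i" "b \<in> part (sub_lsa G S) j" for a b i j
      using that brk_part cl by simp
    show "brk (sub_lsa G S) a b = - scl (sub_lsa G S) (super_sign i j) (brk (sub_lsa G S) b a)"
      if "a \<in> part (sub_lsa G S) i" "b \<in> part (sub_lsa G S) j" for a b i j
      using that super_skew[of a i b j] by simp
    show "brk (sub_lsa G S) a (brk (sub_lsa G S) b c) = brk (sub_lsa G S) (brk (sub_lsa G S) a b) c
        + scl (sub_lsa G S) (super_sign i j) (brk (sub_lsa G S) b (brk (sub_lsa G S) a c))"
      if "a \<in> part (sub_lsa G S) i" "b \<in> part (sub_lsa G S) j" "c \<in> part (sub_lsa G S) k"
      for a b c i j k
      using that super_jacobi[of a i b j c k] by simp
  qed (use car in \<open>simp_all add: lcarrier_sub_lsa[OF assms] subset_iff brk_add_left brk_add_right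
      brk_scale_left brk_scale_right\<close>)
qed

text \<open>If x and x + y have the same parity, so has y, and a nonzero y cannot have both
  parities. This later reads the dimensions 9 and 8 off the parities of the generators.\<close>

lemma part_span_Un:
  assumes "X \<subseteq> part G 0" "Y \<subseteq> part G 1"
  shows "part G 0 \<inter> span (X \<union> Y) = span X" "part G 1 \<inter> span (X \<union> Y) = span Y"
proof -
  have XY: "span X \<subseteq> part G 0" "span Y \<subseteq> part G 1"
    using assms span_minimal[OF _ part_subspace] by blast+
  have *: "y = 0" if "x \<in> part G i" "x + y \<in> part G i" "y \<in> part G j" "i \<noteq> j" for x y i j
  proof -
    have "y \<in> part G i"
      using subspace_diff[OF part_subspace that(2,1)] by simp
    then show ?thesis
      using that(3,4) part_disjoint bit_UNIV_cases[of i] bit_UNIV_cases[of j] by auto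
  qed
  show "part G 0 \<inter> span (X \<union> Y) = span X"
  proof
    show "part G 0 \<inter> span (X \<union> Y) \<subseteq> span X"
      using XY *[of _ 0 _ 1] unfolding span_Un by fastforce
  qed (use XY span_mono[of X "X \<union> Y"] in auto)
  show "part G 1 \<inter> span (X \<union> Y) = span Y"
  proof
    show "part G 1 \<inter> span (X \<union> Y) \<subseteq> span Y"
      using XY *[of _ 1 _ 0] unfolding span_Un by (fastforce simp: add.commute)
  qed (use XY span_mono[of Y "X \<union> Y"] in auto)
qed

text \<open>Applying ad t - \<open>w m\<close> to the sum kills component m and multiplies every
  other component i by \<open>w i - w m\<close>, which is nonzero; the induction removes one
  eigenvalue at a time. Only the sum is assumed to lie in \<open>U\<close>.\<close>

lemma eigen_components:
  assumes t: "t \<in> lcarrier G" and v: "\<And>i. i \<in> I \<Longrightarrow> v i \<in> lcarrier G"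
    and w: "\<And>i. i \<in> I \<Longrightarrow> brk G t (v i) = scl G (w i) (v i)"
    and U: "subspace U" "\<And>u. u \<in> U \<Longrightarrow> brk G t u \<in> U"
    and fin: "finite I" and sum: "(\<Sum>i\<in>I. v i) \<in> U" and inj: "inj_on w I" and i: "i \<in> I"
  shows "v i \<in> U"
  using fin v w sum inj i
proof (induction I arbitrary: v i rule: finite_induct)
  case (insert m I)
  let ?s = "\<Sum>i\<in>insert m I. v i"
  have s: "?s \<in> U" "?s = v m + (\<Sum>i\<in>I. v i)"
    using insert by auto
  have "brk G t ?s - scl G (w m) ?s \<in> U"
    using U s(1) by (intro subspace_diff subspace_scale) auto
  moreover have "brk G t ?s - scl G (w m) ?s = (\<Sum>i\<in>I. scl G (w i - w m) (v i))"
  proof -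
    have "brk G t ?s = (\<Sum>i\<in>insert m I. scl G (w i) (v i))"
      using insert.prems t by (subst brk_sum_right) (auto intro!: sum.cong)
    then show ?thesis
      using insert.hyps by (simp add: scale_sum_right scale_right_distrib scale_left_diff_distrib
        sum_subtractf)
  qed
  ultimately have *: "(\<Sum>i\<in>I. scl G (w i - w m) (v i)) \<in> U" by simp
  have rest: "v j \<in> U" if "j \<in> I" for j
  proof -
    have "scl G (w j - w m) (v j) \<in> U"
    proof (rule insert.IH[OF _ _ * _ that])
      show "scl G (w i - w m) (v i) \<in> lcarrier G" if "i \<in> I" for i
        using insert.prems that by (auto intro: subspace_scale[OF subspace_lcarrier])
      show "brk G t (scl G (w i - w m) (v i)) = scl G (w i) (scl G (w i - w m) (v i))" if "i \<in> I"
        for i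
        using insert.prems that t by (simp add: brk_scale_right mult.commute)
      show "inj_on w I" using insert.prems by auto
    qed
    then have "scl G (inverse (w j - w m)) (scl G (w j - w m) (v j)) \<in> U"
      by (rule subspace_scale[OF U(1)])
    moreover have "w j \<noteq> w m"
      using insert that by (auto simp: inj_on_def)
    ultimately show ?thesis by simp
  qed
  have "v m = ?s - (\<Sum>i\<in>I. v i)" using s by simp
  then have "v m \<in> U"
    using s(1) rest by (metis (no_types, lifting) U(1) subspace_diff subspace_sum)
  with rest insert.prems show ?case by auto
qed simp

text \<open>A basis chosen inside \<open>X\<close> keeps ad t diagonal, so the coefficient of
  \<open>z\<close> at an eigenvector with nonzero eigenvalue vanishes. \<open>X\<close> may be
  infinite and dependent, hence the passage to the basis \<open>B\<close> and the finite support
  \<open>F\<close>.\<close>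

lemma brk_kernel_span:
  assumes t: "t \<in> lcarrier G" and X: "X \<subseteq> lcarrier G"
    and ev: "\<And>x. x \<in> X \<Longrightarrow> \<exists>\<mu>. brk G t x = scl G \<mu> x"
    and z: "z \<in> span X" "brk G t z = 0"
  shows "z \<in> span {x \<in> X. brk G t x = 0}"
proof -
  obtain w where w: "\<And>x. x \<in> X \<Longrightarrow> brk G t x = scl G (w x) x"
    using ev by metis
  obtain B where B: "B \<subseteq> X" "independent B" "X \<subseteq> span B"
    using maximal_independent_subset by blast
  have "z \<in> span B"
    using z(1) B(3) span_mono span_span by blast
  then obtain F c where F: "finite F" "F \<subseteq> B" "z = (\<Sum>b\<in>F. scl G (c b) b)"
    unfolding span_explicit by blast
  have FX: "b \<in> X" "b \<in> lcarrier G" if "b \<in> F" for b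
    using that F B X by auto
  have "0 = (\<Sum>b\<in>F. scl G (c b * w b) b)"
    using z(2) unfolding F(3)
    by (subst (asm) brk_sum_right)
      (auto simp: t FX w brk_scale_right intro!: subspace_scale[OF subspace_lcarrier])
  then have cw: "c b * w b = 0" if "b \<in> F" for b
    using independentD[OF B(2) F(1,2) _ that, of "\<lambda>b. c b * w b"] by simp
  have "scl G (c b) b \<in> span {x \<in> X. brk G t x = 0}" if "b \<in> F" for b
  proof (cases "c b = 0")
    case False
    then have "b \<in> {x \<in> X. brk G t x = 0}"
      using cw[OF that] w FX that by simp
    then show ?thesis by (intro span_scale span_base)
  qed (simp add: span_zero)
  then show ?thesis
    unfolding F(3) by (rule span_sum)
qed

end

section \<open>Triangular decomposition\<close>

text \<open>Right-normed words. There is no empty word, so every word has nonzero height.\<close>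

inductive_set ad_words :: "'a lsa \<Rightarrow> ('n \<Rightarrow> 'a) \<Rightarrow> 'a set" for G e where
  gen: "e i \<in> ad_words G e"
| step: "w \<in> ad_words G e \<Longrightarrow> brk G (e i) w \<in> ad_words G e"

text \<open>The scalars \<open>c\<close> and two separate matrices make the relations symmetric in
  \<open>e\<close> and \<open>f\<close>. The normalisation [e,f] = h is not symmetric: by super skew
  symmetry [f,e] is -h or h depending on the parity. Thus every fact about words in \<open>e\<close>
  also holds for words in \<open>f\<close>.\<close>

locale chevalley_relations = lie_superalgebra G for G :: "'a::ab_group_add lsa" +
  fixes h e f :: "'n::finite \<Rightarrow> 'a" and \<tau> :: "'n \<Rightarrow> bit" and c :: "'n \<Rightarrow> complex"
    and A B :: "'n \<Rightarrow> 'n \<Rightarrow> complex"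
  assumes h_part: "h i \<in> part G 0" and e_part: "e i \<in> part G (\<tau> i)" and f_part: "f i \<in> part G (\<tau> i)"
    and brk_hh: "brk G (h i) (h j) = 0"
    and brk_ef: "brk G (e i) (f j) = (if i = j then scl G (c i) (h i) else 0)"
    and brk_he: "brk G (h i) (e j) = scl G (A i j) (e j)"
    and brk_hf: "brk G (h i) (f j) = scl G (B i j) (f j)"
begin

lemma swap: "chevalley_relations G h f e \<tau> (\<lambda>i. - super_sign (\<tau> i) (\<tau> i) * c i) B A"
proof
  show "brk G (f i) (e j) = (if i = j then scl G (- super_sign (\<tau> i) (\<tau> i) * c i) (h i) else 0)"
      for i j
    using super_skew[OF f_part e_part, of i j] brk_ef[of j i] by auto
qed (auto simp: h_part e_part f_part brk_hh brk_he brk_hf)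

lemmas gen_lcarrier = h_part[THEN part_lcarrier] e_part[THEN part_lcarrier] f_part[THEN
    part_lcarrier]

lemma ad_words_homog: "w \<in> ad_words G e \<Longrightarrow> \<exists>k. w \<in> part G k"
proof (induction rule: ad_words.induct)
  case (step w i)
  then obtain k where "w \<in> part G k" by blast
  then have "brk G (e i) w \<in> part G (\<tau> i + k)" by (rule brk_part[OF e_part])
  then show ?case ..
qed (use e_part in blast)

lemma ad_words_lcarrier: "w \<in> ad_words G e \<Longrightarrow> w \<in> lcarrier G"
  using ad_words_homog part_lcarrier by blast

text \<open>An even element acts as a derivation without signs, so eigenvalues add under the
  bracket.\<close>

lemma brk_even_eigen:
  assumes "t \<in> part G 0" "u \<in> part G k" "v \<in> part G l" "brk G t u = scl G \<mu> u"
      "brk G t v = scl G \<nu> v"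
  shows "brk G t (brk G u v) = scl G (\<mu> + \<nu>) (brk G u v)"
  using assms super_jacobi[OF assms(1-3)]
  by (simp add: super_sign_def brk_scale_left brk_scale_right part_lcarrier scale_left_distrib)

lemma ad_words_weight:
  assumes "w \<in> ad_words G e"
  shows "\<exists>\<mu>. \<forall>i. brk G (h i) w = scl G (\<mu> i) w"
  using assms
proof induction
  case (gen j)
  show ?case by (rule exI[of _ "\<lambda>i. A i j"]) (simp add: brk_he)
next
  case (step w j)
  then obtain \<mu> k where "\<forall>i. brk G (h i) w = scl G (\<mu> i) w" "w \<in> part G k"
    using ad_words_homog by blast
  then show ?case
    by (intro exI[of _ "\<lambda>i. A i j + \<mu> i"] allI brk_even_eigen[OF h_part e_part]) (auto simp: brk_he)
qed

text \<open>The factor \<open>Suc n\<close> is the length of the word. It is never 0, which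
  separates the words from the \<open>h i\<close> when \<open>\<epsilon>\<close> is nonzero.\<close>

lemma ad_words_degree:
  assumes t: "t \<in> part G 0" "\<And>i. brk G t (e i) = scl G \<epsilon> (e i)" and w: "w \<in> ad_words G e"
  shows "\<exists>n. brk G t w = scl G (of_nat (Suc n) * \<epsilon>) w"
  using w
proof induction
  case (gen j)
  show ?case by (rule exI[of _ 0]) (simp add: t)
next
  case (step w j)
  then obtain n k where "brk G t w = scl G (of_nat (Suc n) * \<epsilon>) w" "w \<in> part G k"
    using ad_words_homog by blast
  then have "brk G t (brk G (e j) w) = scl G (\<epsilon> + of_nat (Suc n) * \<epsilon>) (brk G (e j) w)"
    by (intro brk_even_eigen[OF t(1) e_part]) (auto simp: t)
  then show ?case by (intro exI[of _ "Suc n"]) (simp add: algebra_simps)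
qed

lemma brk_e_h: "brk G (e i) (h j) \<in> span (ad_words G e)"
  using super_skew[OF e_part h_part, of i j] span_base[OF ad_words.gen[of e i G]]
  by (simp add: brk_he span_neg span_scale)

text \<open>The reason is that \<open>[f\<^sub>j, e\<^sub>i]\<close> is a multiple of \<open>h\<^sub>i\<close>, which acts on words by weights.\<close>

lemma brk_f_ad_words:
  assumes "w \<in> ad_words G e"
  shows "brk G (f j) w \<in> span (ad_words G e \<union> range h)"
  using assms
proof induction
  case (gen i)
  have "brk G (f j) (e i) = - scl G (super_sign (\<tau> j) (\<tau> i)) (brk G (e i) (f j))"
    by (rule super_skew[OF f_part e_part])
  moreover have "h j \<in> span (ad_words G e \<union> range h)"
    by (rule span_base) simp
  ultimately show ?case
    by (simp add: brk_ef span_neg span_scale span_zero)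
next
  case (step w i)
  let ?S = "span (ad_words G e \<union> range h)"
  obtain k where k: "w \<in> part G k" using step ad_words_homog by blast
  obtain \<mu> where \<mu>: "\<And>i. brk G (h i) w = scl G (\<mu> i) w" using ad_words_weight step by blast
  have fe: "brk G (f j) (e i) = - scl G (super_sign (\<tau> j) (\<tau> i)) (brk G (e i) (f j))"
    by (rule super_skew[OF f_part e_part])
  have w: "w \<in> ?S" "w \<in> lcarrier G" using step k part_lcarrier by (auto intro: span_base)
  have "brk G (brk G (f j) (e i)) w \<in> ?S"
  proof (cases "i = j")
    case True
    then have "brk G (f j) (e i) = scl G (- super_sign (\<tau> j) (\<tau> i) * c i) (h i)"
      using fe by (simp add: brk_ef)
    then have "brk G (brk G (f j) (e i)) w = scl G (- super_sign (\<tau> j) (\<tau> i) * c i) (scl G (\<mu> i) w)"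
      using w by (simp only: brk_scale_left gen_lcarrier \<mu>)
    then show ?thesis
      using w by (simp add: span_scale span_neg)
  next
    case False
    then show ?thesis using fe w by (simp add: brk_ef span_zero)
  qed
  moreover have "brk G (e i) (brk G (f j) w) \<in> ?S"
  proof (rule brk_span_right[OF _ _ subspace_span _ step.IH])
    show "brk G (e i) x \<in> ?S" if "x \<in> ad_words G e \<union> range h" for x
      using that span_mono[of "ad_words G e" "ad_words G e \<union> range h"] brk_e_h
      by (auto intro: span_base ad_words.step)
  qed (use ad_words_lcarrier gen_lcarrier in auto)
  ultimately show ?case
    unfolding super_jacobi[OF f_part e_part k] by (intro span_add span_scale)
qed

definition tri :: "'a set" where "tri = ad_words G e \<union> ad_words G f \<union> range h"

text \<open>By the Jacobi identity this property passes to brackets of homogeneous elements. It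
  therefore has to be checked on the generators only, and the bracket of two words never has to be
  expanded.\<close>

definition stab :: "'a \<Rightarrow> bool" where "stab u \<longleftrightarrow> (\<forall>x\<in>tri. brk G u x \<in> span tri)"

lemma tri_swap: "chevalley_relations.tri G h f e = tri"
  unfolding chevalley_relations.tri_def[OF swap] tri_def by blast

lemma stab_swap: "chevalley_relations.stab G h f e = stab"
  unfolding chevalley_relations.stab_def[OF swap, abs_def] stab_def[abs_def] tri_swap ..

lemma tri_homog: "x \<in> tri \<Longrightarrow> \<exists>k. x \<in> part G k"
  using ad_words_homog chevalley_relations.ad_words_homog[OF swap] h_part
  unfolding tri_def by blast

lemma tri_lcarrier: "tri \<subseteq> lcarrier G"
  using tri_homog part_lcarrier by blast

lemma stab_e: "stab (e i)"
  unfolding stab_def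
proof
  fix x assume "x \<in> tri"
  then consider "x \<in> ad_words G e" | "x \<in> ad_words G f" | j where "x = h j"
    unfolding tri_def by blast
  then show "brk G (e i) x \<in> span tri"
  proof cases
    case 1 then show ?thesis by (auto simp: tri_def intro: span_base ad_words.step)
  next
    case 2
    have "span (ad_words G f \<union> range h) \<subseteq> span tri"
      by (rule span_mono) (auto simp: tri_def)
    then show ?thesis
      \<comment> \<open>With \<open>e\<close> and \<open>f\<close> exchanged, the lemma bounds the
        bracket of \<open>e i\<close> with a word in \<open>f\<close>.\<close>
      using chevalley_relations.brk_f_ad_words[OF swap 2] by auto
  next
    case 3
    have "span (ad_words G e) \<subseteq> span tri"
      by (rule span_mono) (auto simp: tri_def)
    then show ?thesis using brk_e_h 3 by auto
  qed
qed

lemma tri_weight: "x \<in> tri \<Longrightarrow> \<exists>\<mu>. \<forall>i. brk G (h i) x = scl G (\<mu> i) x"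
  using ad_words_weight[of x] chevalley_relations.ad_words_weight[OF swap, of x]
    exI[of "\<lambda>\<mu>. \<forall>i. brk G (h i) x = scl G (\<mu> i) x" "\<lambda>_. 0"]
  by (auto simp: tri_def brk_hh)

lemma stab_h: "stab (h i)"
  unfolding stab_def
proof
  fix x assume x: "x \<in> tri"
  then obtain \<mu> where "brk G (h i) x = scl G (\<mu> i) x" using tri_weight by blast
  then show "brk G (h i) x \<in> span tri" using x by (simp add: span_scale span_base)
qed

lemma stab_brk:
  assumes "u \<in> part G k" "v \<in> part G l" "stab u" "stab v"
  shows "stab (brk G u v)"
  unfolding stab_def
proof
  fix x assume x: "x \<in> tri"
  then obtain m where m: "x \<in> part G m" using tri_homog by blast
  have *: "brk G a y \<in> span tri" if "a \<in> part G k" "stab a" "y \<in> span tri" for a k y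
    by (rule brk_span_right[OF part_lcarrier[OF that(1)] tri_lcarrier subspace_span _ that(3)])
      (use that in \<open>auto simp: stab_def\<close>)
  have "brk G u x \<in> span tri" "brk G v x \<in> span tri"
    using assms(3,4) x by (auto simp: stab_def)
  then have "brk G u (brk G v x) \<in> span tri" "brk G v (brk G u x) \<in> span tri"
    using * assms by blast+
  then have "brk G u (brk G v x) - scl G (super_sign k l) (brk G v (brk G u x)) \<in> span tri"
    by (intro span_diff span_scale)
  then show "brk G (brk G u v) x \<in> span tri"
    using super_jacobi[OF assms(1,2) m] by simp
qed

lemma stab_ad_words: "w \<in> ad_words G e \<Longrightarrow> stab w"
proof (induction rule: ad_words.induct)
  case (step w i)
  then obtain k where "w \<in> part G k" using ad_words_homog by blast
  then show ?case by (rule stab_brk[OF e_part _ stab_e step.IH])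
qed (rule stab_e)

lemma tri_subalgebra: "lsa_subalgebra G (span tri)"
proof (rule span_subalgebra)
  have "stab x" if "x \<in> tri" for x
    using that stab_ad_words stab_h chevalley_relations.stab_ad_words[OF swap]
    unfolding tri_def stab_swap by blast
  then show "brk G x y \<in> span tri" if "x \<in> tri" "y \<in> tri" for x y
    using that by (auto simp: stab_def)
  show "tri \<subseteq> part G 0 \<union> part G 1"
  proof
    fix x assume "x \<in> tri"
    then obtain k where "x \<in> part G k" using tri_homog by blast
    then show "x \<in> part G 0 \<union> part G 1" using bit_UNIV_cases[of k] by auto
  qed
qed

text \<open>The element \<open>\<rho> = \<Sum> r\<^sub>i h\<^sub>i\<close> grades the subalgebra by the height of roots.\<close>

lemma kernel_height:
  assumes r: "\<And>j. (\<Sum>i\<in>UNIV. r i * A i j) = 1" and B: "\<And>i j. B i j = - A i j"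
    and z: "z \<in> span tri" "brk G (\<Sum>i\<in>UNIV. scl G (r i) (h i)) z = 0"
  shows "z \<in> span (range h)"
proof -
  let ?t = "\<Sum>i\<in>UNIV. scl G (r i) (h i)"
  have t0: "?t \<in> part G 0"
    by (intro subspace_sum[OF part_subspace] subspace_scale[OF part_subspace] h_part)
  have brk_t: "brk G ?t x = (\<Sum>i\<in>UNIV. scl G (r i) (brk G (h i) x))" if "x \<in> lcarrier G" for x
    using that by (subst brk_sum_left)
      (auto simp: brk_scale_left gen_lcarrier subspace_scale[OF subspace_lcarrier])
  have te: "brk G ?t (e j) = scl G 1 (e j)" for j
    using r[of j] by (simp add: brk_t gen_lcarrier brk_he flip: scale_sum_left)
  have tf: "brk G ?t (f j) = scl G (- 1) (f j)" for j
    using r[of j] by (simp add: brk_t gen_lcarrier brk_hf B sum_negf flip: scale_sum_left)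
  have th: "brk G ?t (h j) = 0" for j
    by (simp add: brk_t gen_lcarrier brk_hh)
  have we: "\<exists>n. brk G ?t w = scl G (of_nat (Suc n) * 1) w" if "w \<in> ad_words G e" for w
    by (rule ad_words_degree[OF t0 te that])
  have wf: "\<exists>n. brk G ?t w = scl G (of_nat (Suc n) * - 1) w" if "w \<in> ad_words G f" for w
    by (rule chevalley_relations.ad_words_degree[OF swap t0 tf that])
  have "z \<in> span {x \<in> tri. brk G ?t x = 0}"
  proof (rule brk_kernel_span[OF part_lcarrier[OF t0] tri_lcarrier _ z])
    show "\<exists>\<mu>. brk G ?t x = scl G \<mu> x" if "x \<in> tri" for x
      using that we[of x] wf[of x] th unfolding tri_def
      by (elim UnE rangeE) (blast, blast, auto intro: exI[of _ 0])
  qed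
  moreover have "{x \<in> tri. brk G ?t x = 0} \<subseteq> span (range h)"
  proof
    fix x assume x: "x \<in> {x \<in> tri. brk G ?t x = 0}"
    \<comment> \<open>A word has eigenvalue plus or minus its length, hence lies in the kernel only
      if it is 0.\<close>
    have "x = 0" if "x \<in> ad_words G e \<union> ad_words G f"
    proof -
      obtain n where "brk G ?t x = scl G (of_nat (Suc n)) x \<or> brk G ?t x = scl G (- of_nat (Suc
        n)) x"
        using \<open>x \<in> ad_words G e \<union> ad_words G f\<close> we[of x] wf[of x] by auto
      then show ?thesis using x by (auto simp del: of_nat_Suc)
    qed
    then show "x \<in> span (range h)"
      using x by (auto simp: tri_def span_zero span_base)
  qed
  ultimately show ?thesis
    using span_minimal[OF _ subspace_span] by blast
qed

end

section \<open>Uniqueness\<close>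

definition prod_lsa :: "'a lsa \<Rightarrow> 'b lsa \<Rightarrow> ('a \<times> 'b) lsa" where
  "prod_lsa G H = \<lparr>scl = \<lambda>k u. (scl G k (fst u), scl H k (snd u)), part = \<lambda>i. part G i \<times> part H i,
     brk = \<lambda>u v. (brk G (fst u) (fst v), brk H (snd u) (snd v))\<rparr>"

lemma prod_lsa_simps [simp]:
  "scl (prod_lsa G H) k u = (scl G k (fst u), scl H k (snd u))"
  "part (prod_lsa G H) i = part G i \<times> part H i"
  "brk (prod_lsa G H) u v = (brk G (fst u) (fst v), brk H (snd u) (snd v))"
  by (simp_all add: prod_lsa_def)

lemma lcarrier_prod_lsa: "lcarrier (prod_lsa G H) = lcarrier G \<times> lcarrier H"
  unfolding lcarrier_def by (auto; force)

lemma lie_superalgebra_prod_lsa: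
  assumes "lie_superalgebra G" "lie_superalgebra H"
  shows "lie_superalgebra (prod_lsa G H)"
proof -
  interpret G: lie_superalgebra G by fact
  interpret H: lie_superalgebra H by fact
  interpret vector_space "scl (prod_lsa G H)"
    by unfold_locales (auto simp: G.scale_left_distrib G.scale_right_distrib H.scale_left_distrib
        H.scale_right_distrib)
  show ?thesis
  proof
    show "subspace (part (prod_lsa G H) i)" for i
      using G.part_subspace[of i] H.part_subspace[of i]
      by (auto simp: subspace_def G.subspace_def H.subspace_def zero_prod_def)
    show "part (prod_lsa G H) 0 \<inter> part (prod_lsa G H) 1 = {0}"
      using G.part_disjoint H.part_disjoint by (auto simp: zero_prod_def)
    show "brk (prod_lsa G H) u v \<in> part (prod_lsa G H) (i + j)"
      if "u \<in> part (prod_lsa G H) i" "v \<in> part (prod_lsa G H) j" for u v i j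
      using that G.brk_part[of "fst u" i "fst v" j] H.brk_part[of "snd u" i "snd v" j]
      by (simp only: prod_lsa_simps mem_Times_iff fst_conv snd_conv simp_thms)
    show "brk (prod_lsa G H) u v = - scl (prod_lsa G H) (super_sign i j) (brk (prod_lsa G H) v u)"
      if "u \<in> part (prod_lsa G H) i" "v \<in> part (prod_lsa G H) j" for u v i j
      using that G.super_skew[of "fst u" i "fst v" j] H.super_skew[of "snd u" i "snd v" j]
      by (auto simp: mem_Times_iff)
    show "brk (prod_lsa G H) u (brk (prod_lsa G H) v w) = brk (prod_lsa G H) (brk (prod_lsa G H) u
      v) w
        + scl (prod_lsa G H) (super_sign i j) (brk (prod_lsa G H) v (brk (prod_lsa G H) u w))"
      if "u \<in> part (prod_lsa G H) i" "v \<in> part (prod_lsa G H) j" "w \<in> part (prod_lsa G H) k"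
      for u v w i j k
      using that G.super_jacobi[of "fst u" i "fst v" j "fst w" k]
        H.super_jacobi[of "snd u" i "snd v" j "snd w" k]
      by (auto simp: mem_Times_iff)
  qed (auto simp: lcarrier_prod_lsa G.brk_add_left G.brk_add_right G.brk_scale_left
      G.brk_scale_right
      H.brk_add_left H.brk_add_right H.brk_scale_left H.brk_scale_right)
qed

text \<open>The kernel of \<open>\<psi>\<close> is a graded ideal of \<open>L\<close>, and a
  surjective homomorphism maps graded ideals to graded ideals. For the two projections of a
  subalgebra of a product this yields the elements a with (a, 0) in it, and likewise on the other
  side.\<close>

lemma image_kernel_ideal:
  assumes L: "lie_superalgebra L" and G: "lie_superalgebra G" and H: "lie_superalgebra H"
    and \<phi>: "lsa_hom L G \<phi>" "\<phi> ` lcarrier L = lcarrier G" and \<psi>: "lsa_hom L H \<psi>"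
  shows "lsa_ideal G (\<phi> ` {l \<in> lcarrier L. \<psi> l = 0})"
proof -
  interpret L: lie_superalgebra L by fact
  interpret G: lie_superalgebra G by fact
  interpret H: lie_superalgebra H by fact
  let ?K = "{l \<in> lcarrier L. \<psi> l = 0}"
  have hom: "\<phi> (a + b) = \<phi> a + \<phi> b" "\<phi> (brk L a b) = brk G (\<phi> a) (\<phi> b)"
      "\<phi> (scl L k a) = scl G k (\<phi> a)"
    "\<psi> (a + b) = \<psi> a + \<psi> b" "\<psi> (brk L a b) = brk H (\<psi> a) (\<psi> b)" "\<psi> (scl L k a) = scl H k (\<psi> a)"
    if "a \<in> lcarrier L" "b \<in> lcarrier L" for a b k
    using that \<phi>(1) \<psi> by (simp_all add: lsa_hom_def)
  have parts: "\<phi> a \<in> part G i" "\<psi> a \<in> part H i" if "a \<in> part L i" for a i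
    using that \<phi>(1) \<psi> by (auto simp: lsa_hom_def)
  have car: "\<psi> a \<in> lcarrier H" if a: "a \<in> lcarrier L" for a
  proof -
    obtain b c where bc: "b \<in> part L 0" "c \<in> part L 1" "a = b + c"
      using a by (auto elim: L.lcarrier_cases)
    then have "\<psi> b \<in> lcarrier H" "\<psi> c \<in> lcarrier H"
      using parts(2) H.part_lcarrier by blast+
    then show ?thesis
      using bc by (simp add: hom L.part_lcarrier H.subspace_add[OF H.subspace_lcarrier])
  qed
  have zero: "\<phi> 0 = 0" "\<psi> 0 = 0"
    using hom(3,6)[of 0 0 0] L.subspace_0[OF L.subspace_lcarrier] by simp_all
  have split: "\<exists>a\<in>part L 0 \<inter> ?K. \<exists>b\<in>part L 1 \<inter> ?K. l = a + b" if "l \<in> ?K" for l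
  proof -
    from that obtain a b where ab: "a \<in> part L 0" "b \<in> part L 1" "l = a + b"
      by (auto elim: L.lcarrier_cases)
    \<comment> \<open>The kernel is graded: the two sides of this equation have different parities,
      so both vanish.\<close>
    then have "\<psi> a = - \<psi> b"
      using that by (simp add: hom L.part_lcarrier eq_neg_iff_add_eq_0)
    then have "\<psi> a \<in> part H 0 \<inter> part H 1"
      using parts[OF ab(1)] parts[OF ab(2)] H.subspace_neg[OF H.part_subspace] by auto
    then have "\<psi> a = 0" "\<psi> b = 0"
      using H.part_disjoint \<open>\<psi> a = - \<psi> b\<close> by auto
    with ab have "a \<in> part L 0 \<inter> ?K" "b \<in> part L 1 \<inter> ?K"
      by (simp_all add: L.part_lcarrier)
    with ab(3) show ?thesis by blast
  qed
  have sub: "G.subspace (\<phi> ` ?K)"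
    unfolding G.subspace_def
  proof (intro conjI ballI allI)
    show "0 \<in> \<phi> ` ?K"
      using zero L.subspace_0[OF L.subspace_lcarrier] by (intro image_eqI[of _ _ 0]) auto
    fix x assume "x \<in> \<phi> ` ?K"
    then obtain l where l: "l \<in> ?K" "x = \<phi> l" by blast
    show "scl G k x \<in> \<phi> ` ?K" for k
      using l by (intro image_eqI[of _ _ "scl L k l"])
        (auto simp: hom L.subspace_scale[OF L.subspace_lcarrier])
    fix y assume "y \<in> \<phi> ` ?K"
    then obtain m where m: "m \<in> ?K" "y = \<phi> m" by blast
    show "x + y \<in> \<phi> ` ?K"
      using l m by (intro image_eqI[of _ _ "l + m"])
        (auto simp: hom L.subspace_add[OF L.subspace_lcarrier])
  qed
  moreover have "\<phi> ` ?K = {a + b |a b. a \<in> part G 0 \<inter> \<phi> ` ?K \<and> b \<in> part G 1 \<inter> \<phi> ` ?K}"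
  proof (intro equalityI subsetI)
    fix x assume "x \<in> \<phi> ` ?K"
    then obtain l where "l \<in> ?K" "x = \<phi> l" by blast
    with split obtain a b where "a \<in> part L 0 \<inter> ?K" "b \<in> part L 1 \<inter> ?K" "x = \<phi> (a + b)"
      by blast
    then show "x \<in> {a + b |a b. a \<in> part G 0 \<inter> \<phi> ` ?K \<and> b \<in> part G 1 \<inter> \<phi> ` ?K}"
      using parts by (auto simp: hom)
  qed (use G.subspace_add[OF sub] in blast)
  moreover have "brk G a x \<in> \<phi> ` ?K" if a: "a \<in> lcarrier G" and x: "x \<in> \<phi> ` ?K" for a x
  proof -
    obtain l m where "l \<in> lcarrier L" "a = \<phi> l" "m \<in> ?K" "x = \<phi> m"
      using a x \<phi>(2) by blast
    then show ?thesis
      using car by (intro image_eqI[of _ _ "brk L l m"]) (auto simp: hom L.brk_lcarrier)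
  qed
  ultimately show ?thesis
    unfolding lsa_ideal_def graded_subspace_def by blast
qed

lemma image_subalgebra:
  assumes L: "lie_superalgebra L" and G: "lie_superalgebra G" and \<phi>: "lsa_hom L G \<phi>"
  shows "lsa_subalgebra G (\<phi> ` lcarrier L)"
proof -
  interpret L: lie_superalgebra L by fact
  interpret G: lie_superalgebra G by fact
  have hom: "\<phi> (a + b) = \<phi> a + \<phi> b" "\<phi> (brk L a b) = brk G (\<phi> a) (\<phi> b)"
      "\<phi> (scl L k a) = scl G k (\<phi> a)"
    if "a \<in> lcarrier L" "b \<in> lcarrier L" for a b k
    using that \<phi> by (simp_all add: lsa_hom_def)
  have parts: "\<phi> a \<in> part G i" if "a \<in> part L i" for a i
    using that \<phi> by (auto simp: lsa_hom_def)
  have zero: "\<phi> 0 = 0"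
    using hom(3)[of 0 0 0] L.subspace_0[OF L.subspace_lcarrier] by simp
  have sub: "G.subspace (\<phi> ` lcarrier L)"
    unfolding G.subspace_def
  proof (intro conjI ballI allI)
    show "0 \<in> \<phi> ` lcarrier L"
      using zero L.subspace_0[OF L.subspace_lcarrier] by (intro image_eqI[of _ _ 0]) auto
  qed (auto simp flip: hom intro!: imageI L.subspace_scale[OF L.subspace_lcarrier]
        L.subspace_add[OF L.subspace_lcarrier])
  moreover have "\<phi> ` lcarrier L
    = {a + b |a b. a \<in> part G 0 \<inter> \<phi> ` lcarrier L \<and> b \<in> part G 1 \<inter> \<phi> ` lcarrier L}"
  proof (intro equalityI subsetI)
    fix x assume "x \<in> \<phi> ` lcarrier L"
    then obtain a b where ab: "a \<in> part L 0" "b \<in> part L 1" "x = \<phi> (a + b)"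
      by (auto elim: L.lcarrier_cases)
    then have "x = \<phi> a + \<phi> b" "\<phi> a \<in> \<phi> ` lcarrier L" "\<phi> b \<in> \<phi> ` lcarrier L"
      by (simp_all add: hom L.part_lcarrier)
    then show "x \<in> {a + b |a b. a \<in> part G 0 \<inter> \<phi> ` lcarrier L \<and> b \<in> part G 1 \<inter> \<phi> ` lcarrier L}"
      using parts ab by blast
  qed (use G.subspace_add[OF sub] in blast)
  moreover have "brk G x y \<in> \<phi> ` lcarrier L" if "x \<in> \<phi> ` lcarrier L" "y \<in> \<phi> ` lcarrier L" for x y
    using that by (auto simp flip: hom intro!: imageI L.brk_lcarrier)
  ultimately show ?thesis
    unfolding lsa_subalgebra_def graded_subspace_def by blast
qed

section \<open>Indexed families in a vector space\<close>

lemma (in vector_space) independent_familyI: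
  assumes "finite I" and L: "\<And>c. (\<Sum>i\<in>I. scale (c i) (v i)) = 0 \<Longrightarrow> \<forall>i\<in>I. c i = 0"
  shows "inj_on v I" "independent (v ` I)"
proof -
  show inj: "inj_on v I"
  proof (rule inj_onI, rule ccontr)
    fix i j assume ij: "i \<in> I" "j \<in> I" "v i = v j" "i \<noteq> j"
    \<comment> \<open>A repeated vector would give the nontrivial relation
      \<open>v i - v j = 0\<close>.\<close>
    let ?c = "\<lambda>k. (if k = i then 1 else 0) - (if k = j then 1 else 0)"
    have "(\<Sum>k\<in>I. scale (?c k) (v k)) = 0"
      using assms ij by (simp add: scale_left_diff_distrib sum_subtractf if_distrib[of
        "\<lambda>a. scale a _"] cong: if_cong)
    from L[OF this] show False using ij by auto
  qed
  show "independent (v ` I)"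
  proof (rule independent_if_scalars_zero)
    fix f x assume f: "(\<Sum>x\<in>v ` I. scale (f x) x) = 0" "x \<in> v ` I"
    then have "(\<Sum>i\<in>I. scale (f (v i)) (v i)) = 0"
      using inj by (simp add: sum.reindex)
    from L[OF this] show "f x = 0" using f(2) by blast
  qed (use assms in simp)
qed

lemma (in vector_space) independent_familyD:
  assumes "finite I" "inj_on v I" "independent (v ` I)" "(\<Sum>i\<in>I. scale (c i) (v i)) = 0" "i \<in> I"
  shows "c i = 0"
proof -
  have "(\<Sum>x\<in>v ` I. scale (c (inv_into I v x)) x) = 0"
    using assms(2,4) by (simp add: sum.reindex)
  then have "c (inv_into I v (v i)) = 0"
    using independentD[of "v ` I" "v ` I" "\<lambda>x. c (inv_into I v x)" "v i"] assms by simp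
  then show "c i = 0" using assms by simp
qed

lemma (in vector_space) span_family:
  assumes "finite I" "z \<in> span (v ` I)"
  obtains c where "z = (\<Sum>i\<in>I. scale (c i) (v i))"
proof -
  have "\<exists>c. z = (\<Sum>i\<in>I. scale (c i) (v i))"
    using assms(2)
  proof (induction rule: span_induct_alt)
    case base
    show ?case by (rule exI[of _ "\<lambda>_. 0"]) simp
  next
    case (step k x y)
    then obtain i c where "i \<in> I" "x = v i" "y = (\<Sum>i\<in>I. scale (c i) (v i))" by blast
    moreover from this have "scale k (v i) = (\<Sum>j\<in>I. scale (if j = i then k else 0) (v j))"
      using assms(1) by (simp add: if_distrib[of "\<lambda>a. scale a _"] cong: if_cong)
    ultimately show ?case
      by (intro exI[of _ "\<lambda>j. (if j = i then k else 0) + c j"])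
        (simp only: scale_left_distrib sum.distrib)
  qed
  then show ?thesis using that by blast
qed

section \<open>The isomorphism as a subalgebra of the product\<close>

lemma chevalley_generators_generate:
  assumes "chevalley_generators G A \<tau> h e f" "lsa_subalgebra G S" "range h \<union> range e \<union> range f \<subseteq> S"
  shows "S = lcarrier G"
  using assms by (simp add: chevalley_generators_def)

lemma chevalley_isomorphism:
  fixes G :: "'a::ab_group_add lsa" and H :: "'b::ab_group_add lsa" and A :: "complex^'n^'n"
  assumes G: "lsa_simple G" "chevalley_generators G A \<tau> h e f"
    and H: "lsa_simple H" "chevalley_generators H A \<tau> h' e' f'"
    and r: "\<And>j. (\<Sum>i\<in>UNIV. r i * A $ i $ j) = 1"
  shows "\<exists>\<phi>. lsa_hom G H \<phi> \<and> inj_on \<phi> (lcarrier G) \<and> \<phi> ` lcarrier G = lcarrier H"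
proof -
  interpret G: lie_superalgebra G using G(1) by (simp add: lsa_simple_def)
  interpret H: lie_superalgebra H using H(1) by (simp add: lsa_simple_def)
  define P where "P = prod_lsa G H"
  interpret P: lie_superalgebra P
    unfolding P_def by (rule lie_superalgebra_prod_lsa) unfold_locales
  note P_simps = prod_lsa_simps[of G H, folded P_def]
  define h2 e2 f2 where "h2 = (\<lambda>i. (h i, h' i))" and "e2 = (\<lambda>i. (e i, e' i))" and
      "f2 = (\<lambda>i. (f i, f' i))"
  interpret P: chevalley_relations P h2 e2 f2 \<tau> "\<lambda>_. 1" "\<lambda>i j. A $ i $ j" "\<lambda>i j. - A $ i $ j"
    using G(2) H(2) unfolding chevalley_generators_def
    by unfold_locales (auto simp: P_simps h2_def e2_def f2_def zero_prod_def)
  let ?D = "P.span P.tri"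
  define L where "L = sub_lsa P ?D"
  have L: "lie_superalgebra L" and carL: "lcarrier L = ?D"
    unfolding L_def by (rule P.lie_superalgebra_sub_lsa P.lcarrier_sub_lsa, rule P.tri_subalgebra)+
  have D_car: "?D \<subseteq> lcarrier G \<times> lcarrier H"
    using P.span_lcarrier[OF P.tri_lcarrier] by (simp add: P_def lcarrier_prod_lsa)
  have homs: "lsa_hom L G fst" "lsa_hom L H snd"
    unfolding lsa_hom_def carL unfolding L_def by (auto simp: P_simps)
  have gens: "range h2 \<union> range e2 \<union> range f2 \<subseteq> ?D"
    using P.span_superset[of P.tri] by (auto simp: P.tri_def intro: ad_words.gen)
  have proj: "lsa_subalgebra G (fst ` ?D)" "lsa_subalgebra H (snd ` ?D)"
    using image_subalgebra[OF L _ homs(1)] image_subalgebra[OF L _ homs(2)]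
      G.lie_superalgebra_axioms H.lie_superalgebra_axioms by (simp_all add: carL)
  have "range h \<union> range e \<union> range f = fst ` (range h2 \<union> range e2 \<union> range f2)"
    "range h' \<union> range e' \<union> range f' = snd ` (range h2 \<union> range e2 \<union> range f2)"
    by (simp_all add: image_Un image_image h2_def e2_def f2_def)
  then have "range h \<union> range e \<union> range f \<subseteq> fst ` ?D" "range h' \<union> range e' \<union> range f' \<subseteq> snd ` ?D"
    using image_mono[OF gens, of fst] image_mono[OF gens, of snd] by simp_all
  then have onto: "fst ` ?D = lcarrier G" "snd ` ?D = lcarrier H"
    using chevalley_generators_generate[OF G(2) proj(1)] chevalley_generators_generate[OF H(2)
      proj(2)]
    by simp_all

  have hG: "inj h" "G.independent (range h)" and hH: "inj h'" "H.independent (range h')"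
    using G(2) H(2) unfolding chevalley_generators_def by auto
  have h_nonzero: "h i \<noteq> 0" "h' i \<noteq> 0" for i
    using hG(2) hH(2) G.dependent_zero H.dependent_zero by (metis rangeI)+
  have h_car: "h i \<in> lcarrier G" "h' i \<in> lcarrier H" for i
    using P.gen_lcarrier(1)[of i] by (simp_all add: P_def lcarrier_prod_lsa h2_def)
  let ?t = "\<Sum>i\<in>UNIV. scl P (r i) (h2 i)"
  have brk_t: "brk P ?t x = (\<Sum>i\<in>UNIV. scl P (r i) (brk P (h2 i) x))" if "x \<in> lcarrier P" for x
    using that by (subst P.brk_sum_left)
      (auto simp: P.brk_scale_left P.gen_lcarrier P.subspace_scale[OF P.subspace_lcarrier])
  \<comment> \<open>The point is that the same coefficients occur on both sides. If one entry is 0,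
    independence makes all of them vanish, and then the other entry is 0 too.\<close>
  have cartan: "\<exists>c. x = (\<Sum>i\<in>UNIV. scl G (c i) (h i)) \<and> y = (\<Sum>i\<in>UNIV. scl H (c i) (h' i))"
    if xy: "(x, y) \<in> ?D" "\<And>i. brk G (h i) x = 0" "\<And>i. brk H (h' i) y = 0" for x y
  proof -
    have "brk P ?t (x, y) = 0"
      using xy D_car by (subst brk_t)
        (auto simp: P_def lcarrier_prod_lsa h2_def simp flip: zero_prod_def)
    then have "(x, y) \<in> P.span (range h2)"
      using P.kernel_height[OF r _ xy(1)] by simp
    then obtain c where "(x, y) = (\<Sum>i\<in>UNIV. scl P (c i) (h2 i))"
      by (rule P.span_family[OF finite])
    then show ?thesis
      by (intro exI[of _ c]) (simp add: prod_eq_iff P_simps h2_def fst_sum snd_sum)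
  qed
  have brk_hh: "brk G (h i) (h j) = 0" "brk H (h' i) (h' j) = 0" for i j
    using P.brk_hh[of i j] by (simp_all add: P_simps h2_def zero_prod_def)
  \<comment> \<open>Types are nonempty, so there is at least one simple root.\<close>
  obtain i :: 'n where True by blast
  have "(h i, 0) \<notin> ?D"
  proof
    assume "(h i, 0) \<in> ?D"
    then obtain c where "h i = (\<Sum>i\<in>UNIV. scl G (c i) (h i))" "0 = (\<Sum>i\<in>UNIV. scl H (c i) (h' i))"
      using cartan[of "h i" 0] brk_hh h_car by auto
    then show False
      using H.independent_familyD[OF finite hH, of c] h_nonzero by simp
  qed
  moreover have "(0, h' i) \<notin> ?D"
  proof
    assume "(0, h' i) \<in> ?D"
    then obtain c where "0 = (\<Sum>i\<in>UNIV. scl G (c i) (h i))" "h' i = (\<Sum>i\<in>UNIV. scl H (c i) (h' i))"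
      using cartan[of 0 "h' i"] brk_hh h_car by auto
    then show False
      using G.independent_familyD[OF finite hG, of c] h_nonzero by simp
  qed
  moreover have K: "fst ` {l \<in> ?D. snd l = 0} = {a. (a, 0) \<in> ?D}"
      "snd ` {l \<in> ?D. fst l = 0} = {b. (0, b) \<in> ?D}"
    by force+
  moreover have "lsa_ideal G (fst ` {l \<in> ?D. snd l = 0})" "lsa_ideal H (snd ` {l \<in> ?D. fst l = 0})"
    using image_kernel_ideal[OF L G.lie_superalgebra_axioms H.lie_superalgebra_axioms homs(1) _
      homs(2)]
      image_kernel_ideal[OF L H.lie_superalgebra_axioms G.lie_superalgebra_axioms homs(2) _ homs(1)]
    by (simp_all add: carL onto)
  then have "{a. (a, 0) \<in> ?D} = {0} \<or> {a. (a, 0) \<in> ?D} = lcarrier G"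
    "{b. (0, b) \<in> ?D} = {0} \<or> {b. (0, b) \<in> ?D} = lcarrier H"
    using G(1) H(1) unfolding K lsa_simple_def by simp_all
  ultimately have ker: "{a. (a, 0) \<in> ?D} = {0}" "{b. (0, b) \<in> ?D} = {0}"
    using h_car[of i] by auto

  have diff: "(a - c, b - d) \<in> ?D" if "(a, b) \<in> ?D" "(c, d) \<in> ?D" for a b c d
    using P.span_diff[OF that] by simp
  have right_unique: "b = d" if "(a, b) \<in> ?D" "(a, d) \<in> ?D" for a b d
  proof -
    have "b - d \<in> {b. (0, b) \<in> ?D}" using diff[OF that] by simp
    then show ?thesis unfolding ker by simp
  qed
  have left_unique: "a = c" if "(a, b) \<in> ?D" "(c, b) \<in> ?D" for a b c
  proof -
    have "a - c \<in> {a. (a, 0) \<in> ?D}" using diff[OF that] by simp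
    then show ?thesis unfolding ker by simp
  qed
  \<comment> \<open>The triviality of the two kernels makes \<open>?D\<close> the graph of an
    injective function.\<close>
  define \<phi> where "\<phi> a = (THE b. (a, b) \<in> ?D)" for a
  have \<phi>: "\<phi> a = b" if "(a, b) \<in> ?D" for a b
    unfolding \<phi>_def by (rule the_equality) (fact that, rule right_unique[OF _ that])
  have \<phi>_mem: "(a, \<phi> a) \<in> ?D" if a: "a \<in> lcarrier G" for a
  proof -
    obtain b where "(a, b) \<in> ?D" using a unfolding onto(1)[symmetric] by fastforce
    then show ?thesis using \<phi> by simp
  qed
  have "lsa_hom G H \<phi>"
    unfolding lsa_hom_def
  proof (intro conjI allI ballI)
    fix a b k assume a: "a \<in> lcarrier G" and b: "b \<in> lcarrier G"
    show "\<phi> (a + b) = \<phi> a + \<phi> b"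
      using P.span_add[OF \<phi>_mem[OF a] \<phi>_mem[OF b]] by (intro \<phi>) simp
    have "brk P (a, \<phi> a) (b, \<phi> b) \<in> ?D"
      using P.tri_subalgebra \<phi>_mem[OF a] \<phi>_mem[OF b] unfolding lsa_subalgebra_def by blast
    then show "\<phi> (brk G a b) = brk H (\<phi> a) (\<phi> b)"
      by (intro \<phi>) (simp add: P_simps)
  next
    fix a k assume a: "a \<in> lcarrier G"
    show "\<phi> (scl G k a) = scl H k (\<phi> a)"
      using P.span_scale[OF \<phi>_mem[OF a], of k] by (intro \<phi>) (simp add: P_simps)
  next
    fix i a assume a: "a \<in> part G i"
    then have "(a, \<phi> a) \<in> {u + v |u v. u \<in> part P 0 \<inter> ?D \<and> v \<in> part P 1 \<inter> ?D}"
      using \<phi>_mem[OF G.part_lcarrier] P.tri_subalgebra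
      unfolding lsa_subalgebra_def graded_subspace_def by blast
    then obtain u v where uv: "u \<in> part P 0" "v \<in> part P 1" "u \<in> ?D" "v \<in> ?D" "(a, \<phi> a) = u + v"
      by blast
    then have parts: "fst u \<in> part G 0" "snd u \<in> part H 0" "fst v \<in> part G 1" "snd v \<in> part H 1"
      and sum: "a = fst u + fst v" "\<phi> a = snd u + snd v"
      by (auto simp: P_simps prod_eq_iff)
    \<comment> \<open>Of the two homogeneous summands of \<open>(a, \<phi> a)\<close>, the one of
      the wrong parity has a first entry of both parities, hence 0. This fact makes its second entry
      0 as well, so \<open>\<phi>\<close> preserves parity.\<close>
    have snd_zero: "snd w = 0" if "w \<in> ?D" "fst w = 0" for w
      using right_unique[of 0 "snd w" 0] that P.span_zero[of P.tri]
        by (cases w) (auto simp: zero_prod_def)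
    show "\<phi> a \<in> part H i"
    proof (cases "i = 0")
      case True
      then have "a - fst u \<in> part G 0"
        using a parts by (intro G.subspace_diff[OF G.part_subspace]) auto
      then have "fst v \<in> part G 0 \<inter> part G 1" using sum parts by simp
      then have "fst v = 0" unfolding G.part_disjoint by simp
      then show ?thesis
        using snd_zero[OF uv(4)] sum parts True by simp
    next
      case False
      then have i: "i = 1" using bit_UNIV_cases[of i] by simp
      then have "a - fst v \<in> part G 1"
        using a parts by (intro G.subspace_diff[OF G.part_subspace]) auto
      then have "fst u \<in> part G 0 \<inter> part G 1" using sum parts by simp
      then have "fst u = 0" unfolding G.part_disjoint by simp
      then show ?thesis
        using snd_zero[OF uv(3)] sum parts i by simp
    qed
  qed
  moreover have "inj_on \<phi> (lcarrier G)"
    by (rule inj_onI) (metis \<phi>_mem left_unique)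
  moreover have "\<phi> ` lcarrier G = lcarrier H"
  proof
    show "\<phi> ` lcarrier G \<subseteq> lcarrier H" using \<phi>_mem D_car by blast
    show "lcarrier H \<subseteq> \<phi> ` lcarrier G"
    proof
      fix b assume "b \<in> lcarrier H"
      then obtain a where "(a, b) \<in> ?D" unfolding onto(2)[symmetric] by fastforce
      then have "\<phi> a = b" "a \<in> lcarrier G" using \<phi> D_car by auto
      then show "b \<in> \<phi> ` lcarrier G" by blast
    qed
  qed
  ultimately show ?thesis by blast
qed

section \<open>The Weyl superalgebra\<close>

text \<open>Names for the x-derivative, the variables and the constants keep the simplifier from
  unfolding polynomials into coefficients. With the derivation rules below, operator identities
  become ring identities in formal symbols.\<close>

definition pd_x :: "cpoly2 \<Rightarrow> cpoly2" where "pd_x = map_poly pderiv"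
definition var_x :: cpoly2 where "var_x = [:[:0, 1:]:]"
definition var_y :: cpoly2 where "var_y = [:0, 1:]"
definition cnst :: "complex \<Rightarrow> cpoly2" where "cnst k = [:[:k:]:]"

lemma coeff_pd_x: "coeff (pd_x p) n = pderiv (coeff p n)"
  by (simp add: pd_x_def coeff_map_poly)

lemma pd_x_add: "pd_x (p + q) = pd_x p + pd_x q"
  by (rule poly_eqI) (simp add: coeff_pd_x pderiv_add)

lemma pd_x_diff: "pd_x (p - q) = pd_x p - pd_x q"
  by (rule poly_eqI) (simp add: coeff_pd_x pderiv_diff)

lemma pd_x_minus: "pd_x (- p) = - pd_x p"
  by (rule poly_eqI) (simp add: coeff_pd_x pderiv_minus)

lemma pderiv_sum: "pderiv (\<Sum>i\<in>A. f i) = (\<Sum>i\<in>A. pderiv (f i))"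
  by (induction A rule: infinite_finite_induct) (auto simp: pderiv_add)

lemma pd_x_mult: "pd_x (p * q) = p * pd_x q + pd_x p * q"
  by (rule poly_eqI)
    (simp add: coeff_pd_x coeff_mult pderiv_sum pderiv_mult sum.distrib, simp add: mult.commute)

text \<open>As a rewrite rule this moves \<open>pd_x\<close> inwards, giving mixed derivatives one
  normal form.\<close>

lemma pd_x_pderiv: "pd_x (pderiv p) = pderiv (pd_x p)"
  by (rule poly_eqI) (simp add: coeff_pd_x coeff_pderiv pderiv_mult pderiv_smult of_nat_poly)

lemma pd_gens:
  "pd_x 0 = 0" "pd_x 1 = 0" "pd_x (numeral w) = 0" "pderiv (numeral w :: cpoly2) = 0"
      "pd_x var_x = 1" "pd_x var_y = 0" "pd_x (cnst k) = 0"
  "pderiv var_x = 0" "pderiv var_y = 1" "pderiv (cnst k) = 0"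
  by (auto simp: pd_x_def var_x_def var_y_def cnst_def map_poly_pCons pderiv_pCons one_pCons
      numeral_poly)

lemma cnst_hom:
  "cnst 0 = 0" "cnst 1 = 1" "cnst (a + b) = cnst a + cnst b" "cnst (a - b) = cnst a - cnst b"
  "cnst (- a) = - cnst a" "cnst (a * b) = cnst a * cnst b" 
  "cnst (numeral w) = numeral w"
  by (auto simp: cnst_def numeral_poly one_pCons)

lemma smult_cnst: "smult [:k:] p = cnst k * p"
  by (simp add: cnst_def)

lemmas op_apply = op_x_def op_y_def d_x_def d_y_def pd_x_def[symmetric] var_x_def[symmetric]
    var_y_def[symmetric]
  op_scale_def smult_cnst op_E_def op_Delta_def op_E_alpha_def op_Delta_alpha_def
lemmas op_calc = pd_x_add pd_x_diff pd_x_minus pd_x_mult pderiv_add pderiv_diff pderiv_minus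
    pderiv_mult pd_x_pderiv pd_gens cnst_hom

section \<open>Scalars and linear operators on superpolynomials\<close>

lemma superpoly_cases:
  obtains a b c d where "(p::superpoly) = (a, b, c, d)"
  by (cases p) auto

lemma superpoly_zero: "(0::superpoly) = (0, 0, 0, 0)"
  by (simp add: zero_prod_def)

abbreviation sscale :: "complex \<Rightarrow> superop" where
  "sscale k \<equiv> coeffwise (smult [:k:])"

lemma sscale_simps:
  "sscale k (p + q) = sscale k p + sscale k q"
  "sscale (k + l) p = sscale k p + sscale l p"
  "sscale k (sscale l p) = sscale (k * l) p"
  "sscale 1 p = p"
  "sscale 0 p = 0"
  "sscale k 0 = 0"
  "sscale k (- p) = - sscale k p"
  "sscale (- k) p = - sscale k p"
  by (cases p rule: superpoly_cases; cases q rule: superpoly_cases;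
      simp add: smult_cnst cnst_hom superpoly_zero algebra_simps)+

lemma op_scale_apply: "(k \<star> D) p = sscale k (D p)"
  by (simp add: op_scale_def)

interpretation op: vector_space op_scale
  by unfold_locales (auto simp: fun_eq_iff op_scale_def sscale_simps)

text \<open>The type \<open>superop\<close> contains all functions, and
  \<open>C \<odot> (A + B) = C \<odot> A + C \<odot> B\<close> needs an additive \<open>C\<close>.
  Linearity is therefore carried along as a predicate, which every element of \<open>weyl\<close>
  satisfies.\<close>

definition superlinear :: "superop \<Rightarrow> bool" where
  "superlinear D \<longleftrightarrow> (\<forall>p q. D (p + q) = D p + D q) \<and> (\<forall>k p. D (sscale k p) = sscale k (D p))"

lemma superlinearD:
  assumes "superlinear D"
  shows "D (p + q) = D p + D q" "D (sscale k p) = sscale k (D p)" "D 0 = 0" "D (- p) = - D p"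
    "D (p - q) = D p - D q"
proof -
  show add: "D (p + q) = D p + D q" and sc: "D (sscale k p) = sscale k (D p)" for p q k
    using assms unfolding superlinear_def by blast+
  show "D 0 = 0" using sc[of 0 0] by (simp only: sscale_simps)
  show minus: "D (- p) = - D p" for p using sc[of "- 1" p] by (simp only: sscale_simps)
  show "D (p - q) = D p - D q" using add[of p "- q"] minus[of q] by simp
qed

lemma weyl_superlinear: "D \<in> weyl \<Longrightarrow> superlinear D"
proof (induction rule: weyl.induct)
  case (weyl_gen D)
  \<comment> \<open>The four even generators act on the four coefficients separately, so it is
    enough to treat one polynomial.\<close>
  have "superlinear (coeffwise F)" if "\<And>a b. F (a + b) = F a + F b"
      "\<And>k a. F (cnst k * a) = cnst k * F a" for F
    unfolding superlinear_def
  proof (intro conjI allI)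
    show "coeffwise F (p + q) = coeffwise F p + coeffwise F q" for p q
      by (cases p rule: superpoly_cases; cases q rule: superpoly_cases) (simp add: that)
    show "coeffwise F (sscale k p) = sscale k (coeffwise F p)" for k p
      by (cases p rule: superpoly_cases) (simp add: that smult_cnst)
  qed
  note lin = this
  have "superlinear op_x" "superlinear op_y" "superlinear d_x" "superlinear d_y"
    unfolding op_x_def op_y_def d_x_def d_y_def pd_x_def[symmetric]
    by (rule lin; simp only: op_calc mult_zero_left mult_zero_right add_0_right ring_distribs
      mult.left_commute)+
  moreover have "superlinear op_theta" "superlinear op_eta" "superlinear d_theta"
      "superlinear d_eta"
    unfolding superlinear_def
    by simp_all
  ultimately show ?case using weyl_gen by auto
next
  case (weyl_add A B)
  then show ?case by (simp add: superlinear_def sscale_simps)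
next
  case (weyl_scale A k)
  then show ?case by (simp add: superlinear_def op_scale_def sscale_simps mult.commute)
qed (simp_all add: superlinear_def del: split_paired_All)

lemma zero_weyl: "0 \<in> weyl"
  using weyl_scale[OF weyl_one, of 0] by simp

lemma diff_weyl: "A \<in> weyl \<Longrightarrow> B \<in> weyl \<Longrightarrow> A - B \<in> weyl"
  using weyl_add[OF _ weyl_scale[of B "- 1"], of A] by simp

section \<open>Parity of superpolynomials and operators\<close>

lemma superpoly_proj_simps:
  "superpoly_proj i (p + q) = superpoly_proj i p + superpoly_proj i q"
  "superpoly_proj i (sscale k p) = sscale k (superpoly_proj i p)"
  "superpoly_proj i 0 = 0"
  by (cases p rule: superpoly_cases; cases q rule: superpoly_cases; simp add: superpoly_zero)+

lemma mem_superpoly_part: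
  "(a, b, c, d) \<in> superpoly_part i \<longleftrightarrow> (if i = 0 then b = 0 \<and> c = 0 else a = 0 \<and> d = 0)"
  unfolding superpoly_part_def by (auto simp: image_iff intro: exI[of _ "(a, b, c, d)"])

lemma superpoly_proj_mem: "superpoly_proj i p \<in> superpoly_part i"
  by (simp add: superpoly_part_def)

lemma superpoly_proj_same: "p \<in> superpoly_part i \<Longrightarrow> superpoly_proj i p = p"
  by (cases p rule: superpoly_cases) (simp add: mem_superpoly_part split: if_splits)

lemma superpoly_proj_other: "p \<in> superpoly_part i \<Longrightarrow> j \<noteq> i \<Longrightarrow> superpoly_proj j p = 0"
  using bit_UNIV_cases[of i] bit_UNIV_cases[of j]
  by (cases p rule: superpoly_cases) (auto simp: mem_superpoly_part superpoly_zero)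

lemma superpoly_proj_sum: "superpoly_proj 0 p + superpoly_proj 1 p = p"
  by (cases p rule: superpoly_cases) simp

lemma superpoly_part_closed:
  "p \<in> superpoly_part i \<Longrightarrow> q \<in> superpoly_part i \<Longrightarrow> p + q \<in> superpoly_part i"
  "p \<in> superpoly_part i \<Longrightarrow> q \<in> superpoly_part i \<Longrightarrow> p - q \<in> superpoly_part i"
  "p \<in> superpoly_part i \<Longrightarrow> sscale k p \<in> superpoly_part i"
  "0 \<in> superpoly_part i"
  by (cases p rule: superpoly_cases; cases q rule: superpoly_cases;
      auto simp: mem_superpoly_part superpoly_zero split: if_splits)+

lemma weyl_partD:
  "D \<in> weyl_part i \<Longrightarrow> D \<in> weyl" "D \<in> weyl_part i \<Longrightarrow> p \<in> superpoly_part j \<Longrightarrow>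
      D p \<in> superpoly_part (i + j)"
  by (auto simp: weyl_part_def)

lemma bit_add_1_neq: "(i::bit) + 1 \<noteq> i"
  using bit_UNIV_cases[of i] by auto

lemma op_homog_part:
  assumes "D \<in> weyl_part i"
  shows "op_homog k D = (if k = i then D else 0)"
proof
  fix p
  have D: "superlinear D" using assms weyl_partD weyl_superlinear by blast
  have *: "D (superpoly_proj 0 p) \<in> superpoly_part i"
      "D (superpoly_proj 1 p) \<in> superpoly_part (i + 1)"
    using weyl_partD(2)[OF assms superpoly_proj_mem] by (metis add.right_neutral)+
  have sum: "D (superpoly_proj 0 p) + D (superpoly_proj 1 p) = D p"
    using superlinearD(1)[OF D] superpoly_proj_sum by metis
  have "k + 1 \<noteq> i + 1" if "k \<noteq> i" using that by (metis add_right_cancel)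
  then show "op_homog k D p = (if k = i then D else 0) p"
    using superpoly_proj_same[OF *(1)] superpoly_proj_same[OF *(2)]
      superpoly_proj_other[OF *(1), of k] superpoly_proj_other[OF *(2), of "k + 1"] sum
    by (auto simp: op_homog_def)
qed

text \<open>Of the four summands in the definition only the one with the parities of
  \<open>A\<close> and \<open>B\<close> survives. Linearity enters because
  \<open>A \<odot> 0 = 0\<close> requires \<open>A 0 = 0\<close>.\<close>

lemma supercommutator_part:
  assumes "A \<in> weyl_part i" "B \<in> weyl_part j"
  shows "supercommutator A B = A \<odot> B - super_sign i j \<star> (B \<odot> A)"
proof -
  have A: "superlinear A" and B: "superlinear B" using assms weyl_partD weyl_superlinear by blast+
  have "A \<odot> 0 = 0" "B \<odot> 0 = 0" "0 \<odot> A = 0" "0 \<odot> B = 0" "(0::superop) \<odot> 0 = (0::superop)"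
    using superlinearD(3)[OF A] superlinearD(3)[OF B] by (auto simp: fun_eq_iff)
  then show ?thesis
    using bit_UNIV_cases[of i] bit_UNIV_cases[of j]
    by (auto simp: supercommutator_def op_homog_part[OF assms(1)] op_homog_part[OF assms(2)])
qed

section \<open>The supercommutator as a Lie superbracket\<close>

lemma superlinear_op_homog: "superlinear A \<Longrightarrow> superlinear (op_homog i A)"
  unfolding superlinear_def[of "op_homog i A"]
  by (intro conjI allI) (simp_all only: op_homog_def plus_fun_apply comp_apply superpoly_proj_simps
      sscale_simps superlinearD add_ac)

lemma op_homog_add: "op_homog i (A + B) = op_homog i A + op_homog i B"
  by (simp add: fun_eq_iff op_homog_def superpoly_proj_simps)

lemma op_homog_scale: "op_homog i (k \<star> A) = k \<star> op_homog i A"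
  by (simp add: fun_eq_iff op_homog_def superpoly_proj_simps op_scale_def sscale_simps)

lemma comp_add:
  "(A + B) \<odot> C = A \<odot> C + B \<odot> C"
  "superlinear C \<Longrightarrow> C \<odot> (A + B) = C \<odot> A + C \<odot> B"
  by (auto simp: fun_eq_iff superlinearD)

lemma comp_scale:
  "(k \<star> A) \<odot> C = k \<star> (A \<odot> C)"
  "superlinear C \<Longrightarrow> C \<odot> (k \<star> A) = k \<star> (C \<odot> A)"
  by (auto simp: fun_eq_iff superlinearD op_scale_def)

lemma supercommutator_add:
  assumes "superlinear A" "superlinear B" "superlinear C"
  shows "supercommutator (A + B) C = supercommutator A C + supercommutator B C"
    "supercommutator C (A + B) = supercommutator C A + supercommutator C B"
  using assms[THEN superlinear_op_homog]
  by (simp_all add: supercommutator_def op_homog_add comp_add op.scale_right_distrib algebra_simps)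

lemma supercommutator_scale:
  assumes "superlinear A" "superlinear C"
  shows "supercommutator (k \<star> A) C = k \<star> supercommutator A C"
    "supercommutator C (k \<star> A) = k \<star> supercommutator C A"
  using assms[THEN superlinear_op_homog]
  by (simp_all add: supercommutator_def op_homog_scale comp_scale op.scale_right_distrib
      op.scale_right_diff_distrib op.scale_left_commute algebra_simps)

lemma weyl_lsa_simps [simp]:
  "scl weyl_lsa = op_scale" "part weyl_lsa = weyl_part" "brk weyl_lsa = supercommutator"
  by (simp_all add: weyl_lsa_def)

lemma lcarrier_weyl: "A \<in> lcarrier weyl_lsa \<Longrightarrow> A \<in> weyl"
  by (auto simp: lcarrier_def intro: weyl_add weyl_partD)

lemma lcarrier_superlinear: "A \<in> lcarrier weyl_lsa \<Longrightarrow> superlinear A"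
  by (rule weyl_superlinear[OF lcarrier_weyl])

lemma supercommutator_weyl_part:
  assumes "A \<in> weyl_part i" "B \<in> weyl_part j"
  shows "supercommutator A B \<in> weyl_part (i + j)"
proof -
  have "(A \<odot> B - super_sign i j \<star> (B \<odot> A)) p \<in> superpoly_part (i + j + k)" if p:
      "p \<in> superpoly_part k" for p k
  proof -
    have "A (B p) \<in> superpoly_part (i + j + k)"
      using weyl_partD(2)[OF assms(1) weyl_partD(2)[OF assms(2) p]] by (simp only: add.assoc)
    moreover have "B (A p) \<in> superpoly_part (i + j + k)"
      using weyl_partD(2)[OF assms(2) weyl_partD(2)[OF assms(1) p]]
        by (simp only: add.left_commute add.assoc)
    ultimately show ?thesis
      by (simp only: minus_apply comp_apply op_scale_def superpoly_part_closed)
  qed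
  moreover have "A \<odot> B - super_sign i j \<star> (B \<odot> A) \<in> weyl"
    using assms weyl_partD by (intro diff_weyl weyl_scale weyl_mult) auto
  ultimately show ?thesis
    unfolding supercommutator_part[OF assms] weyl_part_def by blast
qed

interpretation weyl: lie_superalgebra weyl_lsa
proof (rule lie_superalgebra.intro, unfold weyl_lsa_simps)
  show "vector_space op_scale" by (rule op.vector_space_axioms)
  show "lie_superalgebra_axioms weyl_lsa"
  proof (unfold_locales, unfold weyl_lsa_simps)
    show "op.subspace (weyl_part i)" for i
      unfolding op.subspace_def
    proof (intro conjI ballI allI)
      show "0 \<in> weyl_part i"
        by (simp add: weyl_part_def zero_weyl superpoly_part_closed)
    next
      fix A B assume "A \<in> weyl_part i" "B \<in> weyl_part i"
      then show "A + B \<in> weyl_part i"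
        unfolding weyl_part_def using superpoly_part_closed(1) weyl_add by simp
    next
      fix k A assume "A \<in> weyl_part i"
      then show "k \<star> A \<in> weyl_part i"
        unfolding weyl_part_def using superpoly_part_closed(3) weyl_scale
          by (simp add: op_scale_apply)
    qed
    \<comment> \<open>An operator both even and odd maps a homogeneous superpolynomial into both
      parts, hence to 0.\<close>
    have "A = 0" if "A \<in> weyl_part 0" "A \<in> weyl_part 1" for A
    proof
      fix p
      have A: "superlinear A" using that weyl_partD weyl_superlinear by blast
      have "A (superpoly_proj j p) = 0" for j
      proof -
        have "A (superpoly_proj j p) \<in> superpoly_part j"
          "A (superpoly_proj j p) \<in> superpoly_part (j + 1)"
          using weyl_partD(2)[OF that(1) superpoly_proj_mem[of j p]] weyl_partD(2)[OF that(2)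
            superpoly_proj_mem[of j p]]
          by (simp_all only: add_0 add.commute[of 1])
        then show ?thesis
          using superpoly_proj_same[of _ j] superpoly_proj_other[of _ "j + 1" j] bit_add_1_neq[of
            j] by metis
      qed
      then show "A p = 0 p"
        using superlinearD(1)[OF A, of "superpoly_proj 0 p" "superpoly_proj 1 p"]
          by (simp add: superpoly_proj_sum)
    qed
    moreover have "0 \<in> weyl_part i" for i
      by (simp add: weyl_part_def zero_weyl superpoly_part_closed)
    ultimately show "weyl_part 0 \<inter> weyl_part 1 = {0}" by blast
    show "supercommutator A B \<in> weyl_part (i + j)" if "A \<in> weyl_part i" "B \<in> weyl_part j"
      for A B i j
      by (rule supercommutator_weyl_part[OF that])
    show "supercommutator A B = - (super_sign i j \<star> supercommutator B A)"
      if "A \<in> weyl_part i" "B \<in> weyl_part j" for A B i j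
    proof -
      have "super_sign i j = super_sign j i" "super_sign i j * super_sign i j = 1"
        by (auto simp: super_sign_def)
      then show ?thesis
        unfolding supercommutator_part[OF that] supercommutator_part[OF that(2,1)]
        by (simp add: op.scale_right_diff_distrib)
    qed
    show "supercommutator A (supercommutator B C) = supercommutator (supercommutator A B) C
        + super_sign i j \<star> supercommutator B (supercommutator A C)"
      if "A \<in> weyl_part i" "B \<in> weyl_part j" "C \<in> weyl_part k" for A B C i j k
    proof -
      have "superlinear A" "superlinear B" "superlinear C"
        using that weyl_partD weyl_superlinear by blast+
      note lin = this[THEN superlinearD(2)] this[THEN superlinearD(4)] this[THEN superlinearD(5)]
        this[THEN superlinearD(1)]
      note inner = supercommutator_part[OF that(1,2)] supercommutator_part[OF that(2,3)]
        supercommutator_part[OF that(1,3)]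
      note outer = supercommutator_part[OF that(1) supercommutator_weyl_part[OF that(2,3)],
        unfolded inner]
        supercommutator_part[OF supercommutator_weyl_part[OF that(1,2)] that(3), unfolded inner]
        supercommutator_part[OF that(2) supercommutator_weyl_part[OF that(1,3)], unfolded inner]
      \<comment> \<open>In each of the eight parity cases the signs are numbers, and both sides
        expand to the same signed sum of triple products.\<close>
      show ?thesis
        unfolding inner outer
        using bit_UNIV_cases[of i] bit_UNIV_cases[of j] bit_UNIV_cases[of k]
        by (elim disjE) (simp_all add: fun_eq_iff super_sign_def op_scale_def lin sscale_simps
          algebra_simps del: split_paired_All)
    qed
  qed (auto simp: lcarrier_superlinear supercommutator_add supercommutator_scale)
qed

section \<open>The bracket table\<close>

definition gen :: "complex \<Rightarrow> nat \<Rightarrow> superop" where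
  "gen \<alpha> i = D21_ops \<alpha> ! i"

definition gen_parity :: "nat \<Rightarrow> bit" where
  "gen_parity i = [0, 0, 1, 1, 0, 0, 0, 0, 0, 1, 1, 1, 1, 0, 0, 1, 1] ! i"

text \<open>The entry \<open>(j, [(c, k), \<dots>])\<close> in row \<open>i \<le> j\<close> says that the supercommutator of
  operators \<open>i\<close> and \<open>j\<close> is \<open>c\<close> times operator \<open>k\<close> plus \<open>\<dots>\<close>; missing entries are zero.\<close>

definition bracket_rows :: "complex \<Rightarrow> (nat \<times> (complex \<times> nat) list) list list" where
  "bracket_rows \<alpha> = [
   [(5, [(- 1, 0)]), (6, [(- 1, 0)]), (10, [(- 1, 2)]), (12, [(- 1, 3)]),
    (13, [(- 1, 5), (- 1, 6)]), (15, [(- 1, 9)]), (16, [(1, 11)])],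
   [(5, [(1, 1)]), (6, [(- 1, 1)]), (9, [(- 1, 3)]), (11, [(- 1, 2)]),
    (14, [(1, 5), (- 1, 6)]), (15, [(- 1, 12)]), (16, [(1, 10)])],
   [(4, [(- 1, 2)]), (6, [(- 1, 2)]), (8, [(- 1, 3)]), (9, [(\<alpha>, 0)]), (12, [(1, 1)]),
    (13, [(- 1, 10)]), (14, [(- 1, 11)]),
    (15, [(- ((1 + \<alpha>) / 2), 4), (- ((1 - \<alpha>) / 2), 5), ((1 + \<alpha>) / 2, 6)]),
    (16, [(- (1 + \<alpha>), 7)])],
   [(4, [(1, 3)]), (6, [(- 1, 3)]), (7, [(- 1, 2)]), (10, [(- 1, 1)]), (11, [(- \<alpha>, 0)]),
    (13, [(- 1, 12)]), (14, [(- 1, 9)]), (15, [(- (1 + \<alpha>), 8)]),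
    (16, [((1 + \<alpha>) / 2, 4), (- ((1 - \<alpha>) / 2), 5), ((1 + \<alpha>) / 2, 6)])],
   [(7, [(2, 7)]), (8, [(- 2, 8)]), (9, [(- 1, 9)]), (10, [(1, 10)]), (11, [(1, 11)]),
    (12, [(- 1, 12)]), (15, [(- 1, 15)]), (16, [(1, 16)])],
   [(9, [(1, 9)]), (10, [(- 1, 10)]), (11, [(1, 11)]), (12, [(- 1, 12)]), (13, [(- 1, 13)]),
    (14, [(1, 14)])],
   [(13, [(- 1, 13)]), (14, [(- 1, 14)]), (15, [(- 1, 15)]), (16, [(- 1, 16)])],
   [(8, [(1, 4)]), (9, [(1, 11)]), (12, [(1, 10)]), (15, [(- 1, 16)])],
   [(10, [(1, 12)]), (11, [(1, 9)]), (16, [(- 1, 15)])],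
   [(10, [((1 + \<alpha>) / 2, 4), ((1 + \<alpha>) / 2, 5), (- ((1 - \<alpha>) / 2), 6)]),
    (12, [(1 + \<alpha>, 8)]), (13, [(- 1, 15)]), (16, [(1, 14)])],
   [(11, [(- (1 + \<alpha>), 7)]), (14, [(1, 16)]), (15, [(\<alpha>, 13)])],
   [(12, [((1 + \<alpha>) / 2, 4), (- ((1 + \<alpha>) / 2), 5), ((1 - \<alpha>) / 2, 6)]),
    (13, [(1, 16)]), (15, [(1, 14)])],
   [(14, [(- 1, 15)]), (16, [(\<alpha>, 13)])],
   [],
   [],
   [],
   []]"

definition bracket_table :: "complex \<Rightarrow> nat \<Rightarrow> nat \<Rightarrow> (complex \<times> nat) list" where
  "bracket_table \<alpha> i j = (case map_of (bracket_rows \<alpha> ! i) j of None \<Rightarrow> [] | Some l \<Rightarrow> l)"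

lemma all_less_17: "(\<forall>j<17. P j) \<longleftrightarrow> P 0 \<and> P 1 \<and> P 2 \<and> P 3 \<and> P 4 \<and> P 5 \<and> P 6 \<and> P 7 \<and> P 8 \<and> P 9 \<and>
   P 10 \<and> P 11 \<and> P 12 \<and> P 13 \<and> P 14 \<and> P 15 \<and> P (16::nat)"
  by (simp only: numeral_eq_Suc pred_numeral_simps BitM.simps All_less_Suc, simp add: conj_ac)

lemma half_coeffs:
  fixes \<alpha> \<beta> :: complex
  assumes "\<alpha> = 2 * \<beta> - 1"
  shows "(1 + \<alpha>) / 2 = \<beta>" "(1 - \<alpha>) / 2 = 1 - \<beta>" "1 + \<alpha> = 2 * \<beta>"
  by (simp_all add: assms field_simps)

text \<open>On these normal forms the bracket table becomes polynomial algebra. The terms without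
  derivatives come from the odd variables: in \<open>2 * d\<close> for the Euler operator both odd
  Euler terms act on theta eta; in \<open>(1 + cnst \<alpha>) * d\<close> for operator 15 the
  \<alpha> comes from the odd Euler term of \<open>op_E_alpha\<close>, the 1 from
  \<open>op_eta \<odot> op_Delta\<close>.\<close>

lemma gen_apply:
  "gen \<alpha> 0 (a, b, c, d) = (var_x * a, var_x * b, var_x * c, var_x * d)"
  "gen \<alpha> 1 (a, b, c, d) = (var_y * a, var_y * b, var_y * c, var_y * d)"
  "gen \<alpha> 2 (a, b, c, d) = (0, a, 0, c)"
  "gen \<alpha> 3 (a, b, c, d) = (0, 0, a, - b)"
  "gen \<alpha> 4 (a, b, c, d) = (0, b, - c, 0)"
  "gen \<alpha> 5 (a, b, c, d) =
     (- var_y * pderiv a + var_x * pd_x a,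
      - var_y * pderiv b + var_x * pd_x b,
      - var_y * pderiv c + var_x * pd_x c,
      - var_y * pderiv d + var_x * pd_x d)"
  "gen \<alpha> 6 (a, b, c, d) =
     (var_y * pderiv a + var_x * pd_x a,
      b + var_y * pderiv b + var_x * pd_x b,
      c + var_y * pderiv c + var_x * pd_x c,
      2 * d + var_y * pderiv d + var_x * pd_x d)"
  "gen \<alpha> 7 (a, b, c, d) = (0, c, 0, 0)"
  "gen \<alpha> 8 (a, b, c, d) = (0, 0, b, 0)"
  "gen \<alpha> 9 (a, b, c, d) = (cnst \<alpha> * var_x * b, 0, pderiv a + cnst \<alpha> * var_x * d, - pderiv b)"
  "gen \<alpha> 10 (a, b, c, d) = (- var_y * c, pd_x a + var_y * d, 0, pd_x c)"
  "gen \<alpha> 11 (a, b, c, d) = (- cnst \<alpha> * var_x * c, pderiv a + cnst \<alpha> * var_x * d, 0, pderiv c)"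
  "gen \<alpha> 12 (a, b, c, d) = (var_y * b, 0, pd_x a + var_y * d, - pd_x b)"
  "gen \<alpha> 13 (a, b, c, d) =
     (var_x * pd_x (pd_x a) - var_y * d,
      pd_x b + var_x * pd_x (pd_x b),
      pd_x c + var_x * pd_x (pd_x c),
      2 * pd_x d + var_x * pd_x (pd_x d))"
  "gen \<alpha> 14 (a, b, c, d) =
     (var_y * pderiv (pderiv a) - cnst \<alpha> * var_x * d,
      pderiv b + var_y * pderiv (pderiv b),
      pderiv c + var_y * pderiv (pderiv c),
      2 * pderiv d + var_y * pderiv (pderiv d))"
  "gen \<alpha> 15 (a, b, c, d) =
     (var_y * pderiv b + cnst \<alpha> * var_x * pd_x b,
      0,
      pderiv (pd_x a) + (1 + cnst \<alpha>) * d + var_y * pderiv d + cnst \<alpha> * var_x * pd_x d,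
      - pderiv (pd_x b))"
  "gen \<alpha> 16 (a, b, c, d) =
     (var_y * pderiv c + cnst \<alpha> * var_x * pd_x c,
      - pderiv (pd_x a) - (1 + cnst \<alpha>) * d - var_y * pderiv d - cnst \<alpha> * var_x * pd_x d,
      0,
      - pderiv (pd_x c))"
  by (simp_all add: gen_def D21_ops_def op_apply superpoly_zero; simp add: op_calc algebra_simps)+

lemma gen_parity_simps:
  "gen_parity 0 = 0" "gen_parity 1 = 0" "gen_parity 2 = 1" "gen_parity 3 = 1" "gen_parity 4 = 0"
  "gen_parity 5 = 0" "gen_parity 6 = 0" "gen_parity 7 = 0" "gen_parity 8 = 0"
  "gen_parity 9 = 1" "gen_parity 10 = 1" "gen_parity 11 = 1" "gen_parity 12 = 1"
  "gen_parity 13 = 0" "gen_parity 14 = 0" "gen_parity 15 = 1" "gen_parity 16 = 1"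
  by (simp_all add: gen_parity_def)

lemma super_sign_simps: "super_sign 0 i = 1" "super_sign i 0 = 1" "super_sign 1 1 = - 1"
  by (auto simp: super_sign_def)

primrec lincomb :: "complex \<Rightarrow> (complex \<times> nat) list \<Rightarrow> superop" where
  "lincomb \<alpha> [] = 0"
| "lincomb \<alpha> (p # l) = fst p \<star> gen \<alpha> (snd p) + lincomb \<alpha> l"

definition table_entry :: "complex \<Rightarrow> nat \<Rightarrow> nat \<Rightarrow> bool" where
  "table_entry \<alpha> i j \<longleftrightarrow> gen \<alpha> i \<odot> gen \<alpha> j - super_sign (gen_parity i) (gen_parity j) \<star>
      (gen \<alpha> j \<odot> gen \<alpha> i) = lincomb \<alpha> (bracket_table \<alpha> i j)"

text \<open>Substituting \<open>\<alpha> = 2\<beta> - 1\<close> turns the coefficients with denominator 2 into polynomials.\<close>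

lemma table_entry_parametrised:
  assumes "\<alpha> = 2 * \<beta> - 1"
  shows "\<forall>i<17. \<forall>j<17. i \<le> j \<longrightarrow> table_entry \<alpha> i j"
  unfolding all_less_17
  by (intro conjI impI;
      ((simp; fail) |
        (simp add: table_entry_def gen_parity_simps super_sign_simps bracket_table_def
          bracket_rows_def half_coeffs[OF assms] del: One_nat_def)?;
        (simp add: fun_eq_iff gen_apply op_scale_apply smult_cnst superpoly_zero op_calc assms
          del: One_nat_def)?;
        (simp add: algebra_simps zero_prod_def del: One_nat_def)?))

lemma table_entry:
  assumes "i \<le> j" "j < 17"
  shows "table_entry \<alpha> i j"
proof -
  have "\<alpha> = 2 * ((1 + \<alpha>) / 2) - 1" by (simp add: field_simps)
  from table_entry_parametrised[OF this] show ?thesis using assms by simp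
qed

section \<open>From the table to a graded subalgebra\<close>

lemma D21_ops_gen: "D21_ops \<alpha> = map (gen \<alpha>) [0..<17]"
  by (rule nth_equalityI) (simp_all add: gen_def D21_ops_def)

lemma set_D21_ops: "set (D21_ops \<alpha>) = gen \<alpha> ` {..<17}"
  by (simp add: D21_ops_gen lessThan_atLeast0)

lemma gen_weyl:
  assumes "i < 17"
  shows "gen \<alpha> i \<in> weyl"
proof -
  have "set (D21_ops \<alpha>) \<subseteq> weyl"
    unfolding D21_ops_def op_E_def op_Delta_def op_E_alpha_def op_Delta_alpha_def
    by (simp add: diff_weyl weyl_add weyl_scale weyl_mult weyl_gen)
  then show ?thesis using assms set_D21_ops by blast
qed

lemma gen_superlinear: "i < 17 \<Longrightarrow> superlinear (gen \<alpha> i)"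
  using gen_weyl weyl_superlinear by blast

lemma gen_part:
  assumes "i < 17"
  shows "gen \<alpha> i \<in> weyl_part (gen_parity i)"
proof -
  have "\<forall>i<17. \<forall>a b c d. (a, b, c, d) \<in> superpoly_part 0 \<longrightarrow>
      gen \<alpha> i (a, b, c, d) \<in> superpoly_part (gen_parity i)"
    "\<forall>i<17. \<forall>a b c d. (a, b, c, d) \<in> superpoly_part 1 \<longrightarrow>
      gen \<alpha> i (a, b, c, d) \<in> superpoly_part (gen_parity i + 1)"
    unfolding all_less_17 by (simp_all add: mem_superpoly_part gen_apply gen_parity_simps op_calc
      del: One_nat_def)
  then have "gen \<alpha> i p \<in> superpoly_part (gen_parity i + j)" if "p \<in> superpoly_part j" for p j
    using assms that bit_UNIV_cases[of j]
      by (cases p rule: superpoly_cases) (auto simp: add.right_neutral)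
  then show ?thesis
    using gen_weyl[OF assms] by (simp add: weyl_part_def)
qed

definition bracket_list :: "complex \<Rightarrow> nat \<Rightarrow> nat \<Rightarrow> (complex \<times> nat) list" where
  "bracket_list \<alpha> i j = (if i \<le> j then bracket_table \<alpha> i j
     else map (\<lambda>(c, k). (- super_sign (gen_parity i) (gen_parity j) * c, k)) (bracket_table \<alpha> j i))"

text \<open>The table is verified for \<open>i \<le> j\<close> only; the other brackets follow by
  super skew symmetry, with the sign multiplied into the coefficients.\<close>

lemma supercommutator_gen:
  assumes "i < 17" "j < 17"
  shows "supercommutator (gen \<alpha> i) (gen \<alpha> j) = lincomb \<alpha> (bracket_list \<alpha> i j)"
proof -
  have le: "supercommutator (gen \<alpha> i) (gen \<alpha> j) = lincomb \<alpha> (bracket_table \<alpha> i j)"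
    if "i \<le> j" "j < 17" for i j
    using table_entry[OF that] supercommutator_part[OF gen_part gen_part, of i j] that
    by (simp add: table_entry_def)
  have scale: "s \<star> lincomb \<alpha> l = lincomb \<alpha> (map (\<lambda>(c, k). (s * c, k)) l)" for s l
    by (induction l) (simp_all only: lincomb.simps list.map split_beta fst_conv snd_conv
        op.scale_zero_right op.scale_right_distrib op.scale_scale)
  show ?thesis
  proof (cases "i \<le> j")
    case True
    then show ?thesis using le assms by (simp add: bracket_list_def)
  next
    case False
    then have "supercommutator (gen \<alpha> i) (gen \<alpha> j)
      = (- super_sign (gen_parity i) (gen_parity j)) \<star> lincomb \<alpha> (bracket_table \<alpha> j i)"
      using weyl.super_skew[of "gen \<alpha> i" "gen_parity i" "gen \<alpha> j"
        "gen_parity j"] gen_part assms le[of j i] by simp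
    then show ?thesis
      using False by (simp only: scale bracket_list_def if_False)
  qed
qed

lemma bracket_table_index:
  assumes "i < 17" "(c, k) \<in> set (bracket_table \<alpha> i j)"
  shows "k < 17"
proof -
  have *: "\<forall>r\<in>set (bracket_rows \<alpha>). \<forall>e\<in>set r. \<forall>p\<in>set (snd e). snd p < 17"
    by (simp add: bracket_rows_def)
  have "bracket_rows \<alpha> ! i \<in> set (bracket_rows \<alpha>)"
    using assms(1) by (intro nth_mem) (simp add: bracket_rows_def)
  moreover from assms(2) obtain l where "map_of (bracket_rows \<alpha> ! i) j = Some l" and l:
      "(c, k) \<in> set l"
    unfolding bracket_table_def by (cases "map_of (bracket_rows \<alpha> ! i) j") auto
  then have "(j, l) \<in> set (bracket_rows \<alpha> ! i)"
    by (intro map_of_SomeD)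
  ultimately show ?thesis
    using bspec[OF bspec[OF bspec[OF *]], of "bracket_rows \<alpha> ! i" "(j, l)" "(c, k)"] l by simp
qed

lemma gen_bracket_span:
  assumes "i < 17" "j < 17"
  shows "supercommutator (gen \<alpha> i) (gen \<alpha> j) \<in> op.span (gen \<alpha> ` {..<17})"
proof -
  have *: "lincomb \<alpha> l \<in> op.span (gen \<alpha> ` {..<17})" if "\<And>c k. (c, k) \<in> set l \<Longrightarrow> k < 17" for l
    using that
  proof (induction l)
    case (Cons x l)
    then have "gen \<alpha> (snd x) \<in> gen \<alpha> ` {..<17}" by (cases x) auto
    moreover have "lincomb \<alpha> l \<in> op.span (gen \<alpha> ` {..<17})"
      by (rule Cons.IH) (use Cons.prems in auto)
    ultimately show ?case
      unfolding lincomb.simps by (intro op.span_add op.span_scale[OF op.span_base])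
  qed (simp only: lincomb.simps op.span_zero)
  show ?thesis
    unfolding supercommutator_gen[OF assms]
      by (rule *) (use assms in \<open>auto simp: bracket_list_def split: if_splits dest:
      bracket_table_index[rotated]\<close>)
qed

lemma D21_span_gen: "D21_span \<alpha> = op.span (gen \<alpha> ` {..<17})"
  by (simp add: D21_span_def set_D21_ops)

lemma gen_homog: "gen \<alpha> ` {..<17} \<subseteq> part weyl_lsa 0 \<union> part weyl_lsa 1"
proof
  fix x assume "x \<in> gen \<alpha> ` {..<17}"
  then obtain i where "i < 17" "x = gen \<alpha> i" by auto
  then show "x \<in> part weyl_lsa 0 \<union> part weyl_lsa 1"
    using gen_part[of i \<alpha>] bit_UNIV_cases[of "gen_parity i"] by auto
qed

lemma D21_subalgebra: "lsa_subalgebra weyl_lsa (D21_span \<alpha>)"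
  unfolding D21_span_gen weyl_lsa_simps(1)[symmetric]
  by (rule weyl.span_subalgebra[OF gen_homog]) (use gen_bracket_span in auto)

section \<open>Linear independence and dimension\<close>

lemma sum_less_17: "(\<Sum>i<17. F i) = F 0 + F 1 + F 2 + F 3 + F 4 + F 5 + F 6 + F 7 + F 8 + F 9 + F 10
    + F 11 + F 12 + F 13 + F 14 + F 15 + F (16::nat)"
  for F :: "nat \<Rightarrow> 'a::comm_monoid_add"
  by (simp add: eval_nat_numeral)

lemma cnst_iffs:
  "var_x \<noteq> 0" "var_y \<noteq> 0" "cnst a = 0 \<longleftrightarrow> a = 0" "cnst a = cnst b \<longleftrightarrow> a = b"
  "cnst a * var_x + cnst b * var_y = 0 \<longleftrightarrow> a = 0 \<and> b = 0"
  "cnst a * var_x + cnst b * var_x = 0 \<longleftrightarrow> a + b = 0"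
proof -
  show x: "var_x \<noteq> 0" "var_y \<noteq> 0" and cnst: "cnst a = 0 \<longleftrightarrow> a = 0" "cnst a = cnst b \<longleftrightarrow> a = b"
    and "cnst a * var_x + cnst b * var_y = 0 \<longleftrightarrow> a = 0 \<and> b = 0" for a b
    by (auto simp: var_x_def var_y_def cnst_def)
  have "cnst a * var_x + cnst b * var_x = cnst (a + b) * var_x"
    by (simp add: cnst_hom distrib_right)
  then show "cnst a * var_x + cnst b * var_x = 0 \<longleftrightarrow> a + b = 0"
    using x cnst by simp
qed

text \<open>A vanishing combination is applied to test superpolynomials. The constant 1 sees only
  the four multiplications; x, y, theta and eta then isolate the first-order operators, and x^2, y^2
  and xy the second-order ones.\<close>

lemma gen_independent:
  assumes "(\<Sum>i<17. c i \<star> gen \<alpha> i) = 0"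
  shows "\<forall>i<17. c i = 0"
proof -
  have ev: "(\<Sum>i<17. sscale (c i) (gen \<alpha> i p)) = 0" for p
  proof -
    have "(\<Sum>i\<in>I. c i \<star> gen \<alpha> i) p = (\<Sum>i\<in>I. sscale (c i) (gen \<alpha> i p))" for I
      by (induction I rule: infinite_finite_induct) (auto simp: op_scale_apply)
    from this[of "{..<17}", symmetric] show ?thesis
      unfolding assms zero_fun_apply .
  qed
  note ev = ev[unfolded sum_less_17]
  note simps = gen_apply smult_cnst op_calc superpoly_zero cnst_iffs
  have z0: "c 0 = 0" "c 1 = 0" "c 2 = 0" "c 3 = 0"
    using ev[of "(1, 0, 0, 0)"] by (simp_all add: simps del: One_nat_def)
  have z1: "c 6 = c 5" "c 11 = 0" "c 9 = 0"
    using ev[of "(var_y, 0, 0, 0)"] z0 by (simp_all add: simps del: One_nat_def)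
  have z2: "c 5 = 0" "c 10 = 0" "c 12 = 0"
    using ev[of "(var_x, 0, 0, 0)"] z0 z1 by (simp_all add: simps del: One_nat_def)
  have z3: "c 4 = 0" "c 8 = 0"
    using ev[of "(0, 1, 0, 0)"] z0 z1 z2 by (simp_all add: simps del: One_nat_def)
  have z4: "c 7 = 0"
    using ev[of "(0, 0, 1, 0)"] z0 z1 z2 by (simp_all add: simps del: One_nat_def)
  have z5: "c 13 = 0"
    using ev[of "(var_x * var_x, 0, 0, 0)"] z0 z1 z2 by (simp_all add: simps del: One_nat_def)
  have z6: "c 14 = 0"
    using ev[of "(var_y * var_y, 0, 0, 0)"] z0 z1 z2 by (simp_all add: simps del: One_nat_def)
  have z7: "c 15 = 0" "c 16 = 0"
    using ev[of "(var_x * var_y, 0, 0, 0)"] z0 z1 z2 z5 z6 by (simp_all add: simps del: One_nat_def)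
  show ?thesis
    unfolding all_less_17 using z0 z1 z2 z3 z4 z5 z6 z7 by (simp del: One_nat_def)
qed

lemma gen_family: "inj_on (gen \<alpha>) {..<17}" "op.independent (gen \<alpha> ` {..<17})"
  by (rule op.independent_familyI[OF finite_lessThan], use gen_independent in blast)+

lemma gen_nonzero: "i < 17 \<Longrightarrow> gen \<alpha> i \<noteq> 0"
  using gen_family(2) op.dependent_zero by (metis imageI lessThan_iff)

lemma D21_part:
  "weyl_part j \<inter> D21_span \<alpha> = op.span (gen \<alpha> ` {i. i < 17 \<and> gen_parity i = j})"
proof -
  have X: "gen \<alpha> ` {i. i < 17 \<and> gen_parity i = j} \<subseteq> weyl_part j" for j
    using gen_part by auto
  have split: "gen \<alpha> ` {..<17} = gen \<alpha> ` {i. i < 17 \<and> gen_parity i = 0} \<union> gen \<alpha> ` {i. i < 17 \<and>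
      gen_parity i = 1}"
    using bit_UNIV_cases by (auto simp: image_iff)
  show ?thesis
    using weyl.part_span_Un[of "gen \<alpha> ` {i. i < 17 \<and> gen_parity i = 0}"
      "gen \<alpha> ` {i. i < 17 \<and> gen_parity i = 1}"] X
      bit_UNIV_cases[of j]
    unfolding D21_span_gen split by (elim disjE) simp_all
qed

lemma D21_dim:
  "op.dim (weyl_part 0 \<inter> D21_span \<alpha>) = 9" "op.dim (weyl_part 1 \<inter> D21_span \<alpha>) = 8"
proof -
  have "op.dim (weyl_part j \<inter> D21_span \<alpha>) = card {i. i < 17 \<and> gen_parity i = j}" for j
  proof -
    have "inj_on (gen \<alpha>) {i. i < 17 \<and> gen_parity i = j}"
      "op.independent (gen \<alpha> ` {i. i < 17 \<and> gen_parity i = j})"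
      using inj_on_subset[OF gen_family(1)] op.independent_mono[OF gen_family(2) image_mono]
      by (simp_all add: subset_iff)
    then show ?thesis
      unfolding D21_part by (simp add: op.dim_eq_card_independent card_image)
  qed
  moreover have "{i. i < 17 \<and> gen_parity i = 0} = {0, 1, 4, 5, 6, 7, 8, 13, 14}"
    "{i. i < 17 \<and> gen_parity i = 1} = {2, 3, 9, 10, 11, 12, 15, 16}"
  proof -
    have "\<forall>i<17. gen_parity i = 0 \<longleftrightarrow> i \<in> {0, 1, 4, 5, 6, 7, 8, 13, 14}"
      "\<forall>i<17. gen_parity i = 1 \<longleftrightarrow> i \<in> {2, 3, 9, 10, 11, 12, 15, 16}"
      unfolding all_less_17 by (simp_all add: gen_parity_simps del: One_nat_def)
    then show "{i. i < 17 \<and> gen_parity i = 0} = {0, 1, 4, 5, 6, 7, 8, 13, 14}"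
      "{i. i < 17 \<and> gen_parity i = 1} = {2, 3, 9, 10, 11, 12, 15, 16}" by auto
  qed
  ultimately show "op.dim (weyl_part 0 \<inter> D21_span \<alpha>) = 9" "op.dim (weyl_part 1 \<inter> D21_span \<alpha>) = 8"
    by simp_all
qed

section \<open>Simplicity\<close>

lemma superlinear_closed:
  "superlinear A \<Longrightarrow> superlinear B \<Longrightarrow> superlinear (A + B)"
  "superlinear A \<Longrightarrow> superlinear (k \<star> A)"
  unfolding superlinear_def
  by (simp_all add: op_scale_apply sscale_simps mult.commute del: split_paired_All)

definition cartan :: "complex \<Rightarrow> complex \<Rightarrow> complex \<Rightarrow> complex \<Rightarrow> superop" where
  "cartan \<alpha> a b c = a \<star> gen \<alpha> 4 + b \<star> gen \<alpha> 5 + c \<star> gen \<alpha> 6"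

text \<open>Entry \<open>i\<close> is the root of operator \<open>i\<close> evaluated at
  \<open>cartan \<alpha> a b c\<close>. With delta_1 = -a, delta_2 = (c - b)/2 and delta_3 = (c +
  b)/2 the nonzero entries are the roots of D(2,1;\<alpha>); the three zeros belong to the Cartan
  subalgebra.\<close>

definition weight :: "complex \<Rightarrow> complex \<Rightarrow> complex \<Rightarrow> nat \<Rightarrow> complex" where
  "weight a b c i = [b + c, c - b, a + c, c - a, 0, 0, 0, 2 * a, - 2 * a, b - a, a - b, a + b,
      - a - b,
     - b - c, b - c, - a - c, a - c] ! i"

lemmas bracket_eval = bracket_list_def bracket_table_def bracket_rows_def gen_parity_simps
    super_sign_simps

lemma cartan_superlinear: "superlinear (cartan \<alpha> a b c)"
  unfolding cartan_def by (intro superlinear_closed gen_superlinear) simp_all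

lemma cartan_part: "cartan \<alpha> a b c \<in> weyl_part 0"
proof -
  have "gen \<alpha> 4 \<in> weyl_part 0" "gen \<alpha> 5 \<in> weyl_part 0" "gen \<alpha> 6 \<in> weyl_part 0"
    using gen_part[of 4 \<alpha>] gen_part[of 5 \<alpha>] gen_part[of 6 \<alpha>] by (simp_all add: gen_parity_simps)
  then show ?thesis
    using weyl.part_subspace[of 0] unfolding cartan_def weyl_lsa_simps
    by (intro op.subspace_add op.subspace_scale)
qed

lemma gen_D21_span: "i < 17 \<Longrightarrow> gen \<alpha> i \<in> D21_span \<alpha>"
  unfolding D21_span_gen by (rule op.span_base) simp

lemma D21_span_subspace: "op.subspace (D21_span \<alpha>)"
  unfolding D21_span_gen by (rule op.subspace_span)

lemma cartan_D21_span: "cartan \<alpha> a b c \<in> D21_span \<alpha>"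
  unfolding cartan_def
  by (intro op.subspace_add[OF D21_span_subspace] op.subspace_scale[OF D21_span_subspace]
      gen_D21_span) simp_all

lemma supercommutator_cartan_gen:
  assumes "i < 17"
  shows "supercommutator (cartan \<alpha> a b c) (gen \<alpha> i) = weight a b c i \<star> gen \<alpha> i"
proof -
  have "supercommutator (cartan \<alpha> a b c) (gen \<alpha> i)
      = a \<star> lincomb \<alpha> (bracket_list \<alpha> 4 i) + b \<star> lincomb \<alpha> (bracket_list \<alpha> 5 i) + c \<star> lincomb \<alpha>
        (bracket_list \<alpha> 6 i)"
    unfolding cartan_def using assms
    by (simp add: supercommutator_add supercommutator_scale superlinear_closed gen_superlinear
      supercommutator_gen)
  moreover have "\<forall>i<17. a \<star> lincomb \<alpha> (bracket_list \<alpha> 4 i) + b \<star> lincomb \<alpha> (bracket_list \<alpha> 5 i) +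
      c \<star> lincomb \<alpha> (bracket_list \<alpha> 6 i)
      = weight a b c i \<star> gen \<alpha> i"
    unfolding all_less_17
    by (intro conjI; simp add: bracket_eval weight_def op.scale_left_distrib
      op.scale_left_diff_distrib
        del: One_nat_def)
  ultimately show ?thesis using assms by simp
qed

lemma supercommutator_cartan_cartan: "supercommutator (cartan \<alpha> a b c) (cartan \<alpha> a' b' c') = 0"
proof -
  have "supercommutator (cartan \<alpha> a b c) (cartan \<alpha> a' b' c') = a' \<star> (weight a b c 4 \<star> gen \<alpha> 4)
      + b' \<star> (weight a b c 5 \<star> gen \<alpha> 5) + c' \<star> (weight a b c 6 \<star> gen \<alpha> 6)"
    unfolding cartan_def[of _ a' b' c']
    by (simp add: supercommutator_add supercommutator_scale superlinear_closed gen_superlinear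
        cartan_superlinear supercommutator_cartan_gen)
  then show ?thesis by (simp add: weight_def)
qed

text \<open>A bracket with a single term of nonzero coefficient puts that basis element into
  \<open>I\<close>. It serves both for ideals, in the proof of simplicity, and for subalgebras
  containing the Chevalley generators.\<close>

lemma gen_step:
  assumes "op.subspace I" "supercommutator (gen \<alpha> i) (gen \<alpha> j) \<in> I" "i < 17" "j < 17"
    and "bracket_list \<alpha> i j = [(c, k)]" "c \<noteq> 0"
  shows "gen \<alpha> k \<in> I"
proof -
  have "c \<star> gen \<alpha> k \<in> I"
    using assms by (simp add: supercommutator_gen)
  from op.subspace_scale[OF assms(1) this, of "inverse c"] show ?thesis
    using assms(6) by simp
qed

text \<open>Both hypotheses enter through the structure constants: the walk through the roots
  crosses two brackets with sole coefficient \<alpha> and two with sole coefficient -(1 +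
  \<alpha>).\<close>

lemma D21_simple:
  assumes "\<alpha> \<noteq> 0" "\<alpha> \<noteq> - 1"
  shows "lsa_simple (sub_lsa weyl_lsa (D21_span \<alpha>))"
proof -
  let ?G = "sub_lsa weyl_lsa (D21_span \<alpha>)"
  note car = weyl.lcarrier_sub_lsa[OF D21_subalgebra]
  interpret S: lie_superalgebra ?G
    by (rule weyl.lie_superalgebra_sub_lsa[OF D21_subalgebra])
  have nz: "1 + \<alpha> \<noteq> 0"
    using assms(2) by (metis add.commute add_eq_0_iff)
  have "I = {0} \<or> I = D21_span \<alpha>" if I: "lsa_ideal ?G I" for I
  proof (rule disjCI)
    assume "I \<noteq> D21_span \<alpha>"
    show "I = {0}"
    proof (rule ccontr)
      assume "I \<noteq> {0}"
      have sub: "op.subspace I" and I_span: "I \<subseteq> D21_span \<alpha>"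
        and ideal: "\<And>a b. a \<in> D21_span \<alpha> \<Longrightarrow> b \<in> I \<Longrightarrow> supercommutator a b \<in> I"
        using I S.graded_subspace_lcarrier[of I] unfolding lsa_ideal_def car
        by (auto simp: graded_subspace_def)
      have step: "gen \<alpha> j \<in> I \<Longrightarrow> i < 17 \<Longrightarrow> j < 17 \<Longrightarrow> bracket_list \<alpha> i j = [(c, k)] \<Longrightarrow> c \<noteq> 0 \<Longrightarrow>
        gen \<alpha> k \<in> I" for i j c k
        using gen_step[OF sub ideal[OF gen_D21_span]] by blast
      obtain u where u: "u \<in> I" "u \<noteq> 0"
        using \<open>I \<noteq> {0}\<close> op.subspace_0[OF sub] by blast
      have "u \<in> op.span (gen \<alpha> ` {..<17})"
        using u(1) I_span D21_span_gen by blast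
      then obtain c where c: "u = (\<Sum>i<17. c i \<star> gen \<alpha> i)"
        by (rule op.span_family[OF finite_lessThan])
      \<comment> \<open>4 stands for the Cartan component; the values of \<open>weight 3 4 1\<close> on the roots are distinct
        and nonzero\<close>
      define J :: "nat set" where "J = {0, 1, 2, 3, 4, 7, 8, 9, 10, 11, 12, 13, 14, 15, 16}"
      define v where "v i = (if i = 4 then cartan \<alpha> (c 4) (c 5) (c 6) else c i \<star> gen \<alpha> i)" for i
      have "u = (\<Sum>i\<in>J. v i)"
        unfolding c sum_less_17 J_def by (simp add: v_def cartan_def add_ac del: One_nat_def)
      have comp: "v i \<in> I" if "i \<in> J" for i
      proof (rule weyl.eigen_components[where t = "cartan \<alpha> 3 4 1" and I = J and w =
        "weight 3 4 1", unfolded weyl_lsa_simps])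
        show "cartan \<alpha> 3 4 1 \<in> lcarrier weyl_lsa"
          using weyl.part_lcarrier[of _ 0] cartan_part by simp
        show "v i \<in> lcarrier weyl_lsa" if "i \<in> J" for i
        proof -
          have "v i \<in> D21_span \<alpha>"
            using that unfolding v_def J_def
            by (auto intro!: cartan_D21_span op.subspace_scale[OF D21_span_subspace] gen_D21_span)
          then show ?thesis
            using weyl.graded_subspace_lcarrier D21_subalgebra unfolding lsa_subalgebra_def by blast
        qed
        show "supercommutator (cartan \<alpha> 3 4 1) (v i) = weight 3 4 1 i \<star> v i" if "i \<in> J" for i
        proof (cases "i = 4")
          case True
          then show ?thesis by (simp add: v_def supercommutator_cartan_cartan weight_def)
        next
          case False
          moreover have "i < 17" using that by (auto simp: J_def)
          ultimately show ?thesis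
            by (simp add: v_def supercommutator_scale cartan_superlinear gen_superlinear
                supercommutator_cartan_gen op.scale_left_commute)
        qed
        \<comment> \<open>The fifteen values are the integers from -7 to 7, each taken once.\<close>
        show "inj_on (weight 3 4 1) J"
          by (simp add: inj_on_def J_def weight_def del: One_nat_def)
        show "(\<Sum>i\<in>J. v i) \<in> I" using u \<open>u = (\<Sum>i\<in>J. v i)\<close> by simp
      qed (use sub ideal cartan_D21_span that in \<open>auto simp: J_def\<close>)
      have "\<exists>i\<in>J - {4}. gen \<alpha> i \<in> I"
      proof (cases "\<exists>i\<in>J - {4}. c i \<noteq> 0")
        case True
        then obtain i where i: "i \<in> J" "i \<noteq> 4" "c i \<noteq> 0" by blast
        then have "c i \<star> gen \<alpha> i \<in> I"
          using comp[of i] by (simp add: v_def)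
        from op.subspace_scale[OF sub this, of "inverse (c i)"] have "gen \<alpha> i \<in> I"
          using i(3) by simp
        then show ?thesis using i(1,2) by blast
      next
        case False
        then have "(\<Sum>i\<in>J - {4}. v i) = 0"
          by (intro sum.neutral) (simp add: v_def)
        moreover have "(\<Sum>i\<in>J. v i) = v 4 + (\<Sum>i\<in>J - {4}. v i)"
          by (rule sum.remove) (simp_all add: J_def)
        ultimately have "u = v 4"
          using \<open>u = (\<Sum>i\<in>J. v i)\<close> by simp
        let ?z = "cartan \<alpha> (c 4) (c 5) (c 6)"
        have z: "?z \<in> I" "?z \<noteq> 0"
          using u \<open>u = v 4\<close> by (simp_all add: v_def)
        have gz: "gen \<alpha> k \<in> I" if "k < 17" "weight (c 4) (c 5) (c 6) k \<noteq> 0" for k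
        proof -
          have "supercommutator (gen \<alpha> k) ?z = - (weight (c 4) (c 5) (c 6) k \<star> gen \<alpha> k)"
            using weyl.super_skew[of "gen \<alpha> k" "gen_parity k" ?z 0] gen_part[OF that(1)] cartan_part
            by (simp add: super_sign_simps supercommutator_cartan_gen[OF that(1)])
          moreover have "supercommutator (gen \<alpha> k) ?z \<in> I"
            by (rule ideal[OF gen_D21_span[OF that(1)] z(1)])
          ultimately have "- (weight (c 4) (c 5) (c 6) k \<star> gen \<alpha> k) \<in> I" by simp
          from op.subspace_scale[OF sub this, of "inverse (- weight (c 4) (c 5) (c 6) k)"]
          show ?thesis using that(2) by simp
        qed
        \<comment> \<open>The roots of x, y and theta are linearly independent on the
          three-dimensional Cartan subalgebra, so a nonzero element of it cannot be a common
          zero.\<close>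
        have "weight (c 4) (c 5) (c 6) 0 \<noteq> 0 \<or> weight (c 4) (c 5) (c 6) 1 \<noteq> 0 \<or> weight (c 4) (c 5)
          (c 6) 2 \<noteq> 0"
        proof (rule ccontr)
          assume "\<not> ?thesis"
          then have "c 5 + c 6 = 0" "c 6 = c 5" "c 4 + c 6 = 0"
            by (simp_all add: weight_def)
          then have "c 4 = 0" "c 5 = 0" "c 6 = 0" by simp_all
          then show False using z(2) by (simp add: cartan_def)
        qed
        then show ?thesis using gz[of 0] gz[of 1] gz[of 2] by (auto simp: J_def)
      qed
      then obtain m where m: "m \<in> J - {4}" "gen \<alpha> m \<in> I" by blast
      \<comment> \<open>a closed walk through all fourteen roots\<close>
      have walk:
        "gen \<alpha> 0 \<in> I \<Longrightarrow> gen \<alpha> 2 \<in> I" "gen \<alpha> 2 \<in> I \<Longrightarrow> gen \<alpha> 3 \<in> I" "gen \<alpha> 3 \<in> I \<Longrightarrow> gen \<alpha> 1 \<in> I"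
        "gen \<alpha> 1 \<in> I \<Longrightarrow> gen \<alpha> 12 \<in> I" "gen \<alpha> 12 \<in> I \<Longrightarrow> gen \<alpha> 10 \<in> I" "gen \<alpha> 10 \<in> I \<Longrightarrow> gen \<alpha> 7 \<in> I"
        "gen \<alpha> 7 \<in> I \<Longrightarrow> gen \<alpha> 11 \<in> I" "gen \<alpha> 11 \<in> I \<Longrightarrow> gen \<alpha> 14 \<in> I" "gen \<alpha> 14 \<in> I \<Longrightarrow> gen \<alpha> 16 \<in> I"
        "gen \<alpha> 16 \<in> I \<Longrightarrow> gen \<alpha> 13 \<in> I" "gen \<alpha> 13 \<in> I \<Longrightarrow> gen \<alpha> 15 \<in> I" "gen \<alpha> 15 \<in> I \<Longrightarrow> gen \<alpha> 8 \<in> I"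
        "gen \<alpha> 8 \<in> I \<Longrightarrow> gen \<alpha> 9 \<in> I" "gen \<alpha> 9 \<in> I \<Longrightarrow> gen \<alpha> 0 \<in> I"
        by (rule step[of 0 10 1 2] step[of 2 8 1 3] step[of 3 10 "- 1" 1] step[of 1 15 1 12]
          step[of 12 7 1 10]
          step[of 10 11 "- (1 + \<alpha>)" 7] step[of 7 9 "- 1" 11] step[of 11 15 1 14] step[of 14 10 1 16]
          step[of 16 12 \<alpha> 13] step[of 13 9 "- 1" 15] step[of 15 3 "- (1 + \<alpha>)" 8] step[of 8 11
            "- 1" 9]
          step[of 9 2 \<alpha> 0]; use assms(1) assms(2)[symmetric] in \<open>simp add: bracket_eval del:
            One_nat_def\<close>)+
      have "m \<in> {0, 1, 2, 3, 7, 8, 9, 10, 11, 12, 13, 14, 15, 16}"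
        using m(1) by (auto simp: J_def)
      then have r0: "gen \<alpha> 0 \<in> I"
        using m(2) by (elim insertE emptyE; hypsubst; iprover intro: walk)
      have roots: "gen \<alpha> 0 \<in> I" "gen \<alpha> 1 \<in> I" "gen \<alpha> 2 \<in> I" "gen \<alpha> 3 \<in> I" "gen \<alpha> 7 \<in> I"
        "gen \<alpha> 8 \<in> I" "gen \<alpha> 9 \<in> I" "gen \<alpha> 10 \<in> I" "gen \<alpha> 11 \<in> I" "gen \<alpha> 12 \<in> I"
        "gen \<alpha> 13 \<in> I" "gen \<alpha> 14 \<in> I" "gen \<alpha> 15 \<in> I" "gen \<alpha> 16 \<in> I"
        by (iprover intro: walk r0)+
      have g4: "gen \<alpha> 4 \<in> I"
        using step[of 8 7 1 4] roots by (simp add: bracket_eval)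
      \<comment> \<open>These two brackets are \<open>- gen \<alpha> 5 - gen \<alpha> 6\<close> and
        \<open>gen \<alpha> 5 - gen \<alpha> 6\<close>; together they recover the rest of the Cartan
        subalgebra.\<close>
      have "supercommutator (gen \<alpha> 0) (gen \<alpha> 13) \<in> I" "supercommutator (gen \<alpha> 1) (gen \<alpha> 14) \<in> I"
        using ideal gen_D21_span roots by simp_all
      then have s: "- gen \<alpha> 5 - gen \<alpha> 6 \<in> I" "gen \<alpha> 5 - gen \<alpha> 6 \<in> I"
        by (simp_all add: supercommutator_gen bracket_eval del: One_nat_def)
      have "(- 1 / 2) \<star> ((- gen \<alpha> 5 - gen \<alpha> 6) + (gen \<alpha> 5 - gen \<alpha> 6)) \<in> I"
        using s by (intro op.subspace_scale[OF sub] op.subspace_add[OF sub])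
      moreover have "(- 1 / 2) \<star> ((- gen \<alpha> 5 - gen \<alpha> 6) + (gen \<alpha> 5 - gen \<alpha> 6)) = gen \<alpha> 6"
      proof -
        have "(- gen \<alpha> 5 - gen \<alpha> 6) + (gen \<alpha> 5 - gen \<alpha> 6) = (- 2) \<star> gen \<alpha> 6"
          using op.scale_left_distrib[of "- 1" "- 1" "gen \<alpha> 6"] by simp
        then show ?thesis by simp
      qed
      ultimately have g6: "gen \<alpha> 6 \<in> I" by simp
      have "gen \<alpha> 5 \<in> I"
        using op.subspace_add[OF sub s(2) g6] by simp
      then have "\<forall>i<17. gen \<alpha> i \<in> I"
        unfolding all_less_17 using roots g4 g6 by (simp del: One_nat_def)
      then have "D21_span \<alpha> \<subseteq> I"
        unfolding D21_span_gen by (intro op.span_minimal[OF _ sub]) auto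
      then show False using I_span \<open>I \<noteq> D21_span \<alpha>\<close> by simp
    qed
  qed
  moreover have "supercommutator (gen \<alpha> 4) (gen \<alpha> 7) \<noteq> 0"
    using gen_nonzero[of 7 \<alpha>] by (simp add: supercommutator_gen bracket_eval)
  ultimately show ?thesis
    unfolding lsa_simple_def car using S.lie_superalgebra_axioms gen_D21_span[of 4 \<alpha>]
      gen_D21_span[of 7 \<alpha>] by auto
qed

section \<open>Chevalley generators\<close>

text \<open>The coefficients are forced: they are those of the brackets of
  \<open>chev_e \<alpha> i\<close> and \<open>chev_f \<alpha> i\<close>, read off the table.\<close>

definition chev_h :: "complex \<Rightarrow> 3 \<Rightarrow> superop" where
  "chev_h \<alpha> i = (vector [cartan \<alpha> 0 (- 1) 1, cartan \<alpha> ((1 + \<alpha>) / 2) ((1 - \<alpha>) / 2) (- ((1 + \<alpha>) / 2)),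
     cartan \<alpha> 0 1 1] :: superop ^ 3) $ i"

text \<open>Root vectors for 2 delta_2, delta_1 - delta_2 - delta_3, 2 delta_3, in the order of the
  rows of the Cartan matrix.\<close>

definition chev_e :: "complex \<Rightarrow> 3 \<Rightarrow> superop" where
  "chev_e \<alpha> i = (vector [gen \<alpha> 1, gen \<alpha> 15, gen \<alpha> 0] :: superop ^ 3) $ i"

text \<open>Root vectors for the opposite roots. Changing the sign of \<open>f\<close> changes that
  of \<open>h\<close>; the factors -1 turn the diagonal entries for the even roots into 2 and the
  middle row into (-1, 0, -\<alpha>).\<close>

definition chev_f :: "complex \<Rightarrow> 3 \<Rightarrow> superop" where
  "chev_f \<alpha> i = (vector [(- 1) \<star> gen \<alpha> 14, (- 1) \<star> gen \<alpha> 2, (- 1) \<star> gen \<alpha> 13] :: superop ^ 3) $ i"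

lemmas chev_simps = chev_h_def chev_e_def chev_f_def vector_3

lemma D21_cartan_simps:
  "D21_cartan \<alpha> $ 1 $ 1 = 2" "D21_cartan \<alpha> $ 1 $ 2 = - 1" "D21_cartan \<alpha> $ 1 $ 3 = 0"
  "D21_cartan \<alpha> $ 2 $ 1 = - 1" "D21_cartan \<alpha> $ 2 $ 2 = 0" "D21_cartan \<alpha> $ 2 $ 3 = - \<alpha>"
  "D21_cartan \<alpha> $ 3 $ 1 = 0" "D21_cartan \<alpha> $ 3 $ 2 = - 1" "D21_cartan \<alpha> $ 3 $ 3 = 2"
  by (simp_all add: D21_cartan_def vector_3)

lemma chevalley_brackets:
  "supercommutator (chev_h \<alpha> i) (chev_h \<alpha> j) = 0"
  "supercommutator (chev_e \<alpha> i) (chev_f \<alpha> j) = (if i = j then chev_h \<alpha> i else 0)"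
  "supercommutator (chev_h \<alpha> i) (chev_e \<alpha> j) = (D21_cartan \<alpha> $ i $ j) \<star> chev_e \<alpha> j"
  "supercommutator (chev_h \<alpha> i) (chev_f \<alpha> j) = (- (D21_cartan \<alpha> $ i $ j)) \<star> chev_f \<alpha> j"
proof -
  note eval = chev_simps D21_cartan_simps supercommutator_scale superlinear_closed
      cartan_superlinear gen_superlinear
    supercommutator_cartan_gen supercommutator_gen
  have minus: "supercommutator A (- B) = - supercommutator A B" if "superlinear A" "superlinear B"
      for A B
    using supercommutator_scale(2)[OF that(2,1), of "- 1"] by simp
  have "\<forall>i j. supercommutator (chev_h \<alpha> i) (chev_h \<alpha> j) = 0"
    by (simp add: forall_3 chev_simps supercommutator_cartan_cartan)
  then show "supercommutator (chev_h \<alpha> i) (chev_h \<alpha> j) = 0" by blast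
  have "\<forall>i j. supercommutator (chev_e \<alpha> i) (chev_f \<alpha> j) = (if i = j then chev_h \<alpha> i else 0)"
    by (simp add: forall_3 eval minus bracket_eval cartan_def op.scale_right_distrib
      op.scale_right_diff_distrib
        algebra_simps del: One_nat_def)
  then show "supercommutator (chev_e \<alpha> i) (chev_f \<alpha> j) = (if i = j then chev_h \<alpha> i else 0)" by blast
  have "\<forall>i j. supercommutator (chev_h \<alpha> i) (chev_e \<alpha> j) = (D21_cartan \<alpha> $ i $ j) \<star> chev_e \<alpha> j"
    by (simp add: forall_3 eval weight_def add_divide_distrib diff_divide_distrib)
  then show "supercommutator (chev_h \<alpha> i) (chev_e \<alpha> j) = (D21_cartan \<alpha> $ i $ j) \<star> chev_e \<alpha> j"
      by blast
  have "\<forall>i j. supercommutator (chev_h \<alpha> i) (chev_f \<alpha> j) = (- (D21_cartan \<alpha> $ i $ j)) \<star> chev_f \<alpha> j"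
    by (simp add: forall_3 eval minus weight_def add_divide_distrib diff_divide_distrib)
  then show "supercommutator (chev_h \<alpha> i) (chev_f \<alpha> j) = (- (D21_cartan \<alpha> $ i $ j)) \<star> chev_f \<alpha> j"
      by blast
qed

lemma chevalley_generate:
  assumes "\<alpha> \<noteq> - 1" and S: "lsa_subalgebra (sub_lsa weyl_lsa (D21_span \<alpha>)) S"
    and gens: "range (chev_h \<alpha>) \<union> range (chev_e \<alpha>) \<union> range (chev_f \<alpha>) \<subseteq> S"
  shows "S = D21_span \<alpha>"
proof
  interpret S: lie_superalgebra "sub_lsa weyl_lsa (D21_span \<alpha>)"
    by (rule weyl.lie_superalgebra_sub_lsa[OF D21_subalgebra])
  have nz: "1 + \<alpha> \<noteq> 0"
    using assms(1) by (metis add.commute add_eq_0_iff)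
  have sub: "op.subspace S" and cl: "\<And>a b. a \<in> S \<Longrightarrow> b \<in> S \<Longrightarrow> supercommutator a b \<in> S"
    using S by (auto simp: lsa_subalgebra_def graded_subspace_def)
  show "S \<subseteq> D21_span \<alpha>"
    using S S.graded_subspace_lcarrier weyl.lcarrier_sub_lsa[OF D21_subalgebra]
    unfolding lsa_subalgebra_def by blast
  have mem: "chev_h \<alpha> i \<in> S" "chev_e \<alpha> i \<in> S" "chev_f \<alpha> i \<in> S" for i
    using gens by auto
  have neg: "gen \<alpha> k \<in> S" if "(- 1) \<star> gen \<alpha> k \<in> S" for k
    using op.subspace_neg[OF sub that] by simp
  have e: "gen \<alpha> 1 \<in> S" "gen \<alpha> 15 \<in> S" "gen \<alpha> 0 \<in> S"
    using mem(2)[of 1] mem(2)[of 2] mem(2)[of 3] by (simp_all only: chev_simps)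
  have f: "gen \<alpha> 14 \<in> S" "gen \<alpha> 2 \<in> S" "gen \<alpha> 13 \<in> S"
    using mem(3)[of 1] mem(3)[of 2] mem(3)[of 3] by (simp_all only: chev_simps neg)
  have h: "cartan \<alpha> 0 (- 1) 1 \<in> S" "cartan \<alpha> 0 1 1 \<in> S"
    "cartan \<alpha> ((1 + \<alpha>) / 2) ((1 - \<alpha>) / 2) (- ((1 + \<alpha>) / 2)) \<in> S"
    using mem(1)[of 1] mem(1)[of 2] mem(1)[of 3] by (simp_all only: chev_simps)
  \<comment> \<open>The first and third coroots are \<open>gen \<alpha> 6 - gen \<alpha> 5\<close>
    and \<open>gen \<alpha> 6 + gen \<alpha> 5\<close>. The second contains
    \<open>gen \<alpha> 4\<close> with coefficient (1 + \<alpha>)/2, so \<alpha> \<noteq> -1 is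
    needed to isolate it.\<close>
  have "(1 / 2) \<star> (cartan \<alpha> 0 (- 1) 1 + cartan \<alpha> 0 1 1) \<in> S"
      "(1 / 2) \<star> (cartan \<alpha> 0 1 1 - cartan \<alpha> 0 (- 1) 1) \<in> S"
    by (simp_all only: op.subspace_scale[OF sub] op.subspace_add[OF sub] op.subspace_diff[OF sub] h)
  moreover have "(1 / 2) \<star> (cartan \<alpha> 0 (- 1) 1 + cartan \<alpha> 0 1 1) = gen \<alpha> 6"
    "(1 / 2) \<star> (cartan \<alpha> 0 1 1 - cartan \<alpha> 0 (- 1) 1) = gen \<alpha> 5"
    by (simp_all add: cartan_def op.scale_right_distrib op.scale_right_diff_distrib flip:
      op.scale_left_distrib)
  ultimately have g56: "gen \<alpha> 5 \<in> S" "gen \<alpha> 6 \<in> S" by simp_all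
  have "cartan \<alpha> ((1 + \<alpha>) / 2) ((1 - \<alpha>) / 2) (- ((1 + \<alpha>) / 2)) - ((1 - \<alpha>) / 2) \<star> gen \<alpha> 5
      - (- ((1 + \<alpha>) / 2)) \<star> gen \<alpha> 6 \<in> S"
    using h(3) g56 by (intro op.subspace_diff[OF sub] op.subspace_scale[OF sub])
  then have "((1 + \<alpha>) / 2) \<star> gen \<alpha> 4 \<in> S"
    by (simp add: cartan_def)
  moreover have "inverse ((1 + \<alpha>) / 2) * ((1 + \<alpha>) / 2) = 1"
    by (rule left_inverse) (simp add: nz)
  ultimately have g4: "gen \<alpha> 4 \<in> S"
    using op.subspace_scale[OF sub, of "((1 + \<alpha>) / 2) \<star> gen \<alpha> 4" "inverse ((1 + \<alpha>) / 2)"]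
    by (simp only: op.scale_scale op.scale_one)
  have step: "gen \<alpha> i \<in> S \<Longrightarrow> gen \<alpha> j \<in> S \<Longrightarrow> i < 17 \<Longrightarrow> j < 17 \<Longrightarrow> bracket_list \<alpha> i j = [(c, k)] \<Longrightarrow>
      c \<noteq> 0 \<Longrightarrow> gen \<alpha> k \<in> S" for i j c k
    using gen_step[OF sub cl] by blast
  \<comment> \<open>With simple roots a1, a2, a3, operators 12, 9, 3, 8 belong to a1 + a2, a2 + a3,
    a1 + a2 + a3 and a1 + 2 a2 + a3 = 2 delta_1; operators 11, 10, 16, 7 belong to their
    negatives.\<close>
  have g12: "gen \<alpha> 12 \<in> S" using step[of 1 15 "- 1" 12] e
      by (simp add: bracket_eval del: One_nat_def)
  have g9: "gen \<alpha> 9 \<in> S" using step[of 15 0 1 9] e by (simp add: bracket_eval del: One_nat_def)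
  have g3: "gen \<alpha> 3 \<in> S" using step[of 1 9 "- 1" 3] e g9
      by (simp add: bracket_eval del: One_nat_def)
  have g8: "gen \<alpha> 8 \<in> S" using step[of 15 3 "- (1 + \<alpha>)" 8] e g3 assms(1)[symmetric]
      by (simp add: bracket_eval del: One_nat_def)
  have g11: "gen \<alpha> 11 \<in> S" using step[of 14 2 1 11] f by (simp add: bracket_eval del: One_nat_def)
  have g10: "gen \<alpha> 10 \<in> S" using step[of 2 13 "- 1" 10] f
      by (simp add: bracket_eval del: One_nat_def)
  have g16: "gen \<alpha> 16 \<in> S" using step[of 14 10 "- 1" 16] f g10
      by (simp add: bracket_eval del: One_nat_def)
  have g7: "gen \<alpha> 7 \<in> S" using step[of 2 16 "- (1 + \<alpha>)" 7] f g16 assms(1)[symmetric]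
      by (simp add: bracket_eval del: One_nat_def)
  have "\<forall>i<17. gen \<alpha> i \<in> S"
    unfolding all_less_17 using e f g3 g4 g56 g7 g8 g9 g10 g11 g12 g16 by (simp del: One_nat_def)
  then show "D21_span \<alpha> \<subseteq> S"
    unfolding D21_span_gen by (intro op.span_minimal[OF _ sub]) auto
qed

text \<open>Bracketing a relation between the \<open>chev_h \<alpha> i\<close> with each
  \<open>chev_e \<alpha> j\<close> turns it into the linear system c A = 0, and the Cartan matrix A
  is invertible for \<alpha> \<noteq> -1.\<close>

lemma chev_h_independent:
  assumes "\<alpha> \<noteq> - 1"
  shows "inj (chev_h \<alpha>)" "op.independent (range (chev_h \<alpha>))"
proof -
  have zero: "\<forall>i\<in>UNIV. c i = 0" if c: "(\<Sum>i\<in>UNIV. c i \<star> chev_h \<alpha> i) = 0" for c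
  proof -
    have h: "superlinear (chev_h \<alpha> i)" for i
      using exhaust_3[of i] by (auto simp: chev_simps cartan_superlinear)
    have e: "superlinear (chev_e \<alpha> j)" "chev_e \<alpha> j \<noteq> 0" for j
      using exhaust_3[of j] gen_superlinear[of 1 \<alpha>] gen_superlinear[of 15 \<alpha>] gen_superlinear[of 0 \<alpha>]
        gen_nonzero[of 1 \<alpha>] gen_nonzero[of 15 \<alpha>] gen_nonzero[of 0 \<alpha>]
      by (auto simp: chev_simps simp del: One_nat_def)
    have "(\<Sum>i\<in>UNIV. c i * (D21_cartan \<alpha> $ i $ j)) = 0" for j
    proof -
      have "supercommutator (\<Sum>i\<in>UNIV. c i \<star> chev_h \<alpha> i) (chev_e \<alpha> j)
          = (\<Sum>i\<in>UNIV. c i * (D21_cartan \<alpha> $ i $ j)) \<star> chev_e \<alpha> j"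
        by (simp add: sum_3 supercommutator_add supercommutator_scale superlinear_closed h e
            chevalley_brackets op.scale_left_distrib)
      moreover have "supercommutator 0 (chev_e \<alpha> j) = 0"
        using supercommutator_scale(1)[OF e(1) e(1), of 0 j] by simp
      ultimately show ?thesis using c e(2)[of j] by simp
    qed
    from this[of 1] this[of 2] this[of 3]
    have eqs: "2 * c 1 = c 2" "c 3 = - c 1" "2 * c 3 = \<alpha> * c 2"
      by (simp_all add: sum_3 D21_cartan_simps algebra_simps eq_neg_iff_add_eq_0 add_eq_0_iff2)
    \<comment> \<open>Substituting the first two equations into the third leaves the determinant, up
      to sign, as the factor of \<open>c 1\<close>.\<close>
    have "2 * ((1 + \<alpha>) * c 1) = \<alpha> * (2 * c 1) - 2 * (- c 1)"
      by (simp add: algebra_simps)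
    also have "\<dots> = 0"
      using eqs by simp
    finally have "2 * ((1 + \<alpha>) * c 1) = 0" .
    moreover have "1 + \<alpha> \<noteq> 0"
      using assms by (metis add.commute add_eq_0_iff)
    ultimately have "c 1 = 0" by simp
    with eqs show ?thesis by (auto simp: UNIV_3)
  qed
  show "inj (chev_h \<alpha>)" "op.independent (range (chev_h \<alpha>))"
    by (rule op.independent_familyI[OF finite], rule zero, assumption)+
qed

lemma D21_chevalley:
  assumes "\<alpha> \<noteq> - 1"
  shows "chevalley_generators (sub_lsa weyl_lsa (D21_span \<alpha>)) (D21_cartan \<alpha>) D21_parity
    (chev_h \<alpha>) (chev_e \<alpha>) (chev_f \<alpha>)"
proof -
  have h: "\<forall>i. chev_h \<alpha> i \<in> weyl_part 0 \<inter> D21_span \<alpha>"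
    by (simp add: forall_3 chev_simps cartan_part cartan_D21_span)
  have e: "\<forall>i. chev_e \<alpha> i \<in> weyl_part (D21_parity i) \<inter> D21_span \<alpha>"
    using gen_part[of 1 \<alpha>] gen_part[of 15 \<alpha>] gen_part[of 0 \<alpha>]
    by (simp add: forall_3 chev_simps gen_D21_span D21_parity_def gen_parity_simps del: One_nat_def)
  have f: "\<forall>i. chev_f \<alpha> i \<in> weyl_part (D21_parity i) \<inter> D21_span \<alpha>"
    using gen_part[of 14 \<alpha>] gen_part[of 2 \<alpha>] gen_part[of 13 \<alpha>]
      op.subspace_neg[OF weyl.part_subspace[unfolded weyl_lsa_simps]] op.subspace_neg[OF
        D21_span_subspace]
    by (simp add: forall_3 chev_simps gen_D21_span D21_parity_def gen_parity_simps del: One_nat_def)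
  show ?thesis
    unfolding chevalley_generators_def sub_lsa_simps weyl_lsa_simps weyl.lcarrier_sub_lsa[OF
      D21_subalgebra]
    by (intro conjI allI impI chev_h_independent[OF assms] chevalley_brackets; (elim conjE)?;
        (rule chevalley_generate[OF assms]; assumption)?; rule h[rule_format] e[rule_format]
          f[rule_format])
qed

lemma D21_height:
  assumes "\<alpha> \<noteq> - 1"
  shows "\<exists>r. \<forall>j. (\<Sum>i\<in>UNIV. r i * D21_cartan \<alpha> $ i $ j) = 1"
proof -
  have nz: "1 + \<alpha> \<noteq> 0"
    using assms by (metis add.commute add_eq_0_iff)
  \<comment> \<open>With first entry x, columns 1 and 2 force the entries 2x - 1 and -1 - x; column
    3 then reads 2(1 + \<alpha>)x = \<alpha> - 3.\<close>
  define x where "x = (\<alpha> - 3) / (2 * (1 + \<alpha>))"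
  have x: "2 * (1 + \<alpha>) * x = \<alpha> - 3"
    unfolding x_def times_divide_eq_right
    by (rule nonzero_mult_div_cancel_left) (use nz in \<open>simp del: distrib_left_numeral\<close>)
  define r :: "3 \<Rightarrow> complex" where "r i = (vector [x, 2 * x - 1, - 1 - x] :: complex ^ 3) $ i" for i
  have "\<forall>j. (\<Sum>i\<in>UNIV. r i * D21_cartan \<alpha> $ i $ j) = 1"
    using x by (simp add: forall_3 sum_3 r_def vector_3 D21_cartan_simps algebra_simps)
  then show ?thesis by blast
qed

section \<open>The realisation of D(2,1;\<alpha>)\<close>

theorem proposition5p2:
  fixes \<alpha> :: complex
  assumes "\<alpha> \<noteq> 0" and "\<alpha> \<noteq> - 1"
  shows "distinct (D21_ops \<alpha>) \<and> \<not> module.dependent op_scale (set (D21_ops \<alpha>)) \<and>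
    lsa_subalgebra weyl_lsa (D21_span \<alpha>) \<and>
    is_D21 \<alpha> (sub_lsa weyl_lsa (D21_span \<alpha>)) \<and>
    (\<forall>G :: 'g::ab_group_add lsa. is_D21 \<alpha> G \<longrightarrow>
       (\<exists>\<rho>. realisation G \<rho> \<and> \<rho> ` lcarrier G = D21_span \<alpha>))"
proof (intro conjI allI impI)
  show "distinct (D21_ops \<alpha>)"
    using gen_family(1) by (simp add: D21_ops_gen distinct_map lessThan_atLeast0)
  show "op.independent (set (D21_ops \<alpha>))"
    using gen_family(2) by (simp add: set_D21_ops)
  show "lsa_subalgebra weyl_lsa (D21_span \<alpha>)"
    by (rule D21_subalgebra)
  show "is_D21 \<alpha> (sub_lsa weyl_lsa (D21_span \<alpha>))"
    using D21_simple[OF assms] D21_dim D21_chevalley[OF assms(2)] by (auto simp: is_D21_def)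
  fix G :: "'g lsa"
  assume "is_D21 \<alpha> G"
  then obtain h e f where G: "lsa_simple G" "chevalley_generators G (D21_cartan \<alpha>) D21_parity h e f"
    by (auto simp: is_D21_def)
  obtain r where r: "\<forall>j. (\<Sum>i\<in>UNIV. r i * D21_cartan \<alpha> $ i $ j) = 1"
    using D21_height[OF assms(2)] by blast
  obtain \<phi> where \<phi>: "lsa_hom G (sub_lsa weyl_lsa (D21_span \<alpha>)) \<phi>" "inj_on \<phi> (lcarrier G)"
    "\<phi> ` lcarrier G = D21_span \<alpha>"
    using chevalley_isomorphism[OF G D21_simple[OF assms] D21_chevalley[OF assms(2)], of r] r
    unfolding weyl.lcarrier_sub_lsa[OF D21_subalgebra] by blast
  \<comment> \<open>Scalars and bracket of the subalgebra are those of the Weyl superalgebra, so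
    composing with the inclusion changes only the target.\<close>
  have "lsa_hom G weyl_lsa \<phi>"
    using \<phi>(1) unfolding lsa_hom_def sub_lsa_simps by blast
  then have "realisation G \<phi>"
    using \<phi>(2) by (simp add: realisation_def)
  with \<phi>(3) show "\<exists>\<rho>. realisation G \<rho> \<and> \<rho> ` lcarrier G = D21_span \<alpha>" by blast
qed

end
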